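(* Let $X$ be a metrizable space, and let $A$ be a closed subset of $X$. Then there exists a map $E\colon \mathrm{Met}(A)\to \mathrm{Met}(X)$ such that: (1) for every $d\in \mathrm{Met}(A)$ we have $E(d)|_{A^{2}}=d$; (2) $E$ is an isometric embedding, i.e., for every pair $d,e\in \mathrm{Met}(A)$ we have $\mathcal{D}_{A}(d,e)=\mathcal{D}_{X}(E(d),E(e))$; (3) $E(\mathrm{BMet}(A))\subseteq \mathrm{BMet}(X)$; (4) $E(\mathrm{Comp}(A))\subseteq \mathrm{Comp}(X)$. Furthermore, there is also an isometric extensor $\widetilde{E}\colon \mathrm{CPM}(A)\to \mathrm{CPM}(X)$ of pseudometrics (i.e., $\widetilde{E}(d)|_{A^{2}}=d$ and $\mathcal{D}_{X}(\widetilde{E}(d),\widetilde{E}(e))=\mathcal{D}_{A}(d,e)$ for all $d,e\in \mathrm{CPM}(A)$) such that $\widetilde{E}|_{\mathrm{Met}(A)}=E$. In this setting, $\widetilde{E}(\mathrm{Met}(A))=\widetilde{E}(\mathrm{CPM}(A))\cap \mathrm{Met}(X)$. Thus, the image $E(\mathrm{Met}(A))$ is closed in $\mathrm{Met}(X)$.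
   Context: For a metrizable space $Z$: $\mathrm{Met}(Z)$ is the set of all metrics on $Z$ that generate the given topology of $Z$; $\mathrm{BMet}(Z)$ is the set of bounded metrics in $\mathrm{Met}(Z)$; $\mathrm{Comp}(Z)$ is the set of complete metrics in $\mathrm{Met}(Z)$; $\mathrm{CPM}(Z)$ is the set of all pseudometrics $d\colon Z\times Z\to[0,\infty)$ that are continuous on $Z\times Z$. For $d,e$ in $\mathrm{CPM}(Z)$ (in particular in $\mathrm{Met}(Z)\subseteq\mathrm{CPM}(Z)$), $\mathcal{D}_{Z}(d,e)=\sup_{x,y\in Z}|d(x,y)-e(x,y)|\in[0,\infty]$; this is a metric that may take the value $\infty$. The sets $\mathrm{Met}(Z)$ and $\mathrm{CPM}(Z)$ carry the topology induced by $\mathcal{D}_{Z}$.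
   Formalization: Clause (4) is stated only for completely metrizable X; without this it fails, e.g. for X the rationals and A = {0}, where Comp(A) is nonempty but Comp(X) is empty. *)

theory Defs
  imports "HOL-Analysis.Analysis"
begin

(* A function Z \<times> Z \<rightarrow> [0,\<infinity>) is represented by the curried total function that agrees
   with it on the carrier and takes the value 0 elsewhere.  This makes the representation
   unique, so that equality in HOL is equality of functions on Z \<times> Z.  The value 0 (instead
   of undefined) is needed because the locale Metric_space requires nonnegativity and
   symmetry on the whole type. *)

definition vanishes_off :: "'a set \<Rightarrow> ('a \<Rightarrow> 'a \<Rightarrow> real) \<Rightarrow> bool" where
  "vanishes_off S d \<longleftrightarrow> (\<forall>x y. \<not> (x \<in> S \<and> y \<in> S) \<longrightarrow> d x y = 0)"

definition restrict2 :: "('a \<Rightarrow> 'a \<Rightarrow> real) \<Rightarrow> 'a set \<Rightarrow> 'a \<Rightarrow> 'a \<Rightarrow> real" where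
  "restrict2 d S = (\<lambda>x y. if x \<in> S \<and> y \<in> S then d x y else 0)"

definition pseudometric_on :: "'a set \<Rightarrow> ('a \<Rightarrow> 'a \<Rightarrow> real) \<Rightarrow> bool" where
  "pseudometric_on S d \<longleftrightarrow>
     (\<forall>x\<in>S. \<forall>y\<in>S. 0 \<le> d x y) \<and>
     (\<forall>x\<in>S. d x x = 0) \<and>
     (\<forall>x\<in>S. \<forall>y\<in>S. d x y = d y x) \<and>
     (\<forall>x\<in>S. \<forall>y\<in>S. \<forall>z\<in>S. d x z \<le> d x y + d y z)"

definition Met :: "'a topology \<Rightarrow> ('a \<Rightarrow> 'a \<Rightarrow> real) set" where
  "Met Z = {d. vanishes_off (topspace Z) d \<and> Metric_space (topspace Z) d
             \<and> Metric_space.mtopology (topspace Z) d = Z}"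

definition BMet :: "'a topology \<Rightarrow> ('a \<Rightarrow> 'a \<Rightarrow> real) set" where
  "BMet Z = {d \<in> Met Z. Metric_space.mbounded (topspace Z) d (topspace Z)}"

definition Comp :: "'a topology \<Rightarrow> ('a \<Rightarrow> 'a \<Rightarrow> real) set" where
  "Comp Z = {d \<in> Met Z. Metric_space.mcomplete (topspace Z) d}"

definition CPM :: "'a topology \<Rightarrow> ('a \<Rightarrow> 'a \<Rightarrow> real) set" where
  "CPM Z = {d. vanishes_off (topspace Z) d \<and> pseudometric_on (topspace Z) d
             \<and> continuous_map (prod_topology Z Z) euclideanreal (\<lambda>(x, y). d x y)}"

definition sup_dist :: "'a topology \<Rightarrow> ('a \<Rightarrow> 'a \<Rightarrow> real) \<Rightarrow> ('a \<Rightarrow> 'a \<Rightarrow> real) \<Rightarrow> ennreal" where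
  "sup_dist Z d e = (SUP (x, y) \<in> topspace Z \<times> topspace Z. ennreal \<bar>d x y - e x y\<bar>)"

definition sup_topology ::
  "'a topology \<Rightarrow> ('a \<Rightarrow> 'a \<Rightarrow> real) set \<Rightarrow> ('a \<Rightarrow> 'a \<Rightarrow> real) topology" where
  "sup_topology Z \<F> = topology (\<lambda>U. U \<subseteq> \<F> \<and>
     (\<forall>d\<in>U. \<exists>\<epsilon>>0. \<forall>e\<in>\<F>. sup_dist Z d e < ennreal \<epsilon> \<longrightarrow> e \<in> U))"

lemma openin_sup_topology:
  "openin (sup_topology Z \<F>) U \<longleftrightarrow> U \<subseteq> \<F> \<and>
     (\<forall>d\<in>U. \<exists>\<epsilon>>0. \<forall>e\<in>\<F>. sup_dist Z d e < ennreal \<epsilon> \<longrightarrow> e \<in> U)"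
proof -
  let ?P = "\<lambda>U. U \<subseteq> \<F> \<and>
     (\<forall>d\<in>U. \<exists>\<epsilon>>0. \<forall>e\<in>\<F>. sup_dist Z d e < ennreal \<epsilon> \<longrightarrow> e \<in> U)"
  have "?P (S \<inter> T)" if S: "?P S" and T: "?P T" for S T
  proof (intro conjI ballI)
    show "S \<inter> T \<subseteq> \<F>" using S by blast
    fix d assume "d \<in> S \<inter> T"
    then obtain a b where a: "a > 0" "\<forall>e\<in>\<F>. sup_dist Z d e < ennreal a \<longrightarrow> e \<in> S"
      and b: "b > 0" "\<forall>e\<in>\<F>. sup_dist Z d e < ennreal b \<longrightarrow> e \<in> T"
      using S T by blast
    have "ennreal (min a b) \<le> ennreal a" "ennreal (min a b) \<le> ennreal b"
      by (auto intro: ennreal_leI)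
    then have "\<forall>e\<in>\<F>. sup_dist Z d e < ennreal (min a b) \<longrightarrow> e \<in> S \<inter> T"
      using a(2) b(2) by (meson IntI order_less_le_trans)
    then show "\<exists>\<epsilon>>0. \<forall>e\<in>\<F>. sup_dist Z d e < ennreal \<epsilon> \<longrightarrow> e \<in> S \<inter> T"
      using a(1) b(1) by (intro exI[of _ "min a b"]) auto
  qed
  moreover have "?P (\<Union>\<K>)" if \<K>: "\<forall>K\<in>\<K>. ?P K" for \<K>
  proof (intro conjI ballI)
    show "\<Union>\<K> \<subseteq> \<F>" using \<K> by blast
    fix d assume "d \<in> \<Union>\<K>"
    then obtain K where "K \<in> \<K>" "d \<in> K" by blast
    then obtain a where "a > 0" "\<forall>e\<in>\<F>. sup_dist Z d e < ennreal a \<longrightarrow> e \<in> K"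
      using \<K> by blast
    with \<open>K \<in> \<K>\<close> show "\<exists>\<epsilon>>0. \<forall>e\<in>\<F>. sup_dist Z d e < ennreal \<epsilon> \<longrightarrow> e \<in> \<Union>\<K>"
      by blast
  qed
  ultimately have "istopology ?P"
    unfolding istopology_def by blast
  then show ?thesis
    by (simp add: sup_topology_def topology_inverse')
qed

lemma topspace_sup_topology: "topspace (sup_topology Z \<F>) = \<F>"
proof
  show "topspace (sup_topology Z \<F>) \<subseteq> \<F>"
    using openin_sup_topology[of Z \<F> "topspace (sup_topology Z \<F>)"] by simp
  have "openin (sup_topology Z \<F>) \<F>"
    by (auto simp: openin_sup_topology intro: exI[of _ 1])
  then show "\<F> \<subseteq> topspace (sup_topology Z \<F>)"
    by (rule openin_subset)
qed

end

theory Submission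
  imports Defs
begin

text \<open>
  Fix a metric \<open>\<rho> \<le> 1\<close> generating \<open>X\<close>, complete if possible, and let \<open>\<sigma>\<close> be the \<open>\<rho>\<close>-distance to \<open>A\<close>.
  A partition of unity of Dugundji type on \<open>X - A\<close>, read as a family of probability
  distributions and coupled through one uniform variable \<open>w \<in> [0,1)\<close>, gives maps \<open>f w : X \<rightarrow> A\<close> that
  fix \<open>A\<close>, move \<open>x\<close> by at most \<open>3 \<sigma> x\<close>, and depend continuously on \<open>x\<close> in probability.
  The extension, an integral in the style of Hartman and Mycielski, is
  \[ E(d)(x,y) = \int_0^1 d (f_w x, f_w y) \, dw + \min(\rho(x,y), \sigma(x) + \sigma(y)). \]
  The second term does not depend on \<open>d\<close> and vanishes on \<open>A\<close>, and the first is an average of values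
  of \<open>d\<close>, so \<open>E\<close> is isometric. The second term recovers the topology off \<open>A\<close>, and both together
  recover it at points of \<open>A\<close>. A Cauchy sequence of \<open>E(d)\<close> is \<open>\<rho>\<close>-Cauchy unless \<open>\<sigma>\<close> tends
  to \<open>0\<close> along it, in which case the images of a subsequence under a single \<open>f w\<close> are \<open>d\<close>-Cauchy.
\<close>

subsection \<open>Stone refinements of open covers\<close>

text \<open>Stone's theorem, by M. E. Rudin's argument: at stage \<open>n\<close>, each point not yet covered whose
  \<open>3 / 2 ^ n\<close>-ball lies in the first member of the cover containing it contributes its
  \<open>1 / 2 ^ n\<close>-ball.\<close>

lemma (in Metric_space) sigma_discrete_refinement:
  fixes C :: "'i \<Rightarrow> 'a set"
  assumes opn: "\<And>i. openin mtopology (C i)"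
  shows "\<exists>D :: nat \<Rightarrow> 'i \<Rightarrow> 'a set. (\<forall>n i. openin mtopology (D n i)) \<and> (\<forall>n i. D n i \<subseteq> C i) \<and>
    (\<Union>i. C i) \<subseteq> (\<Union>n i. D n i) \<and>
    (\<forall>x\<in>\<Union>i. C i. \<exists>r>0. \<exists>K. (\<forall>n\<ge>K. \<forall>i. D n i \<inter> mball x r = {}) \<and>
        (\<forall>n i j. D n i \<inter> mball x r \<noteq> {} \<longrightarrow> D n j \<inter> mball x r \<noteq> {} \<longrightarrow> i = j))"
proof -
  obtain R :: "'i rel" where R: "Well_order R" "Field R = UNIV"
    using well_ordering[where 'a = 'i] by (elim exE conjE)
  interpret R: wo_rel R
    by (rule wo_rel.intro) (rule R(1))
  have anti: "i = j" if "(i, j) \<in> R" "(j, i) \<in> R" for i j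
    using R.ANTISYM that by (rule antisymD)
  have "x \<in> C (R.minim {i. x \<in> C i}) \<and> (\<forall>i. x \<in> C i \<longrightarrow> (R.minim {i. x \<in> C i}, i) \<in> R)"
    if "x \<in> (\<Union>i. C i)" for x
  proof -
    have ne: "{i. x \<in> C i} \<subseteq> Field R" "{i. x \<in> C i} \<noteq> {}"
      unfolding R(2) using that by auto
    show ?thesis
      using R.minim_in[OF ne] R.minim_least[OF ne(1)] by simp
  qed
  then have "\<forall>x\<in>\<Union>i. C i. \<exists>l. x \<in> C l \<and> (\<forall>i. x \<in> C i \<longrightarrow> (l, i) \<in> R)"
    by (intro ballI exI)
  from bchoice[OF this] obtain l where
    l_all: "\<forall>x\<in>\<Union>i. C i. x \<in> C (l x) \<and> (\<forall>i. x \<in> C i \<longrightarrow> (l x, i) \<in> R)"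
    by (elim exE)
  have l: "x \<in> C (l x)" if "x \<in> (\<Union>i. C i)" for x
    using bspec[OF l_all that] by (rule conjunct1)
  have l_le: "(l x, i) \<in> R" if "x \<in> C i" for x i
    using bspec[OF l_all, of x] that by auto
  define cen where "cen = (\<lambda>U n i. {x. x \<in> C i \<and> l x = i \<and> x \<notin> U \<and> mball x (3 * (1/2)^n) \<subseteq> C i})"
  \<comment> \<open>\<open>U n\<close> collects what the stages before \<open>n\<close> cover. It
    comes first because the centres of stage \<open>n\<close> have to avoid it; \<open>D\<close> is
    read off afterwards.\<close>
  define U where "U = rec_nat {} (\<lambda>n V. V \<union> (\<Union>i. \<Union>x\<in>cen V n i. mball x ((1/2)^n)))"
  define D where "D = (\<lambda>n i. \<Union>x\<in>cen (U n) n i. mball x ((1/2)^n))"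
  have USuc: "U (Suc n) = U n \<union> (\<Union>i. D n i)" for n
    by (simp add: U_def D_def)
  have U0: "U 0 = {}" by (simp add: U_def)
  have DU: "D n i \<subseteq> U m" if "n < m" for n i m
    using that by (induction m) (auto simp: USuc less_Suc_eq)
  have UD: "x \<in> (\<Union>n i. D n i)" if "x \<in> U n" for x n
    using that by (induction n) (auto simp: USuc U0)
  have CM: "C i \<subseteq> M" for i
    using opn[of i] by (simp add: openin_mtopology)
  show ?thesis
  proof (intro exI[of _ D] conjI allI ballI)
    show "openin mtopology (D n i)" for n i
      unfolding D_def by blast
    show "D n i \<subseteq> C i" for n i
    proof -
      have "mball x ((1/2)^n) \<subseteq> mball x (3 * (1/2)^n)" for x
        by (rule mball_subset_concentric) simp
      then show ?thesis
        unfolding D_def cen_def by blast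
    qed
    show cover: "(\<Union>i. C i) \<subseteq> (\<Union>n i. D n i)"
    proof
      fix x assume x: "x \<in> (\<Union>i. C i)"
      then have "x \<in> C (l x)" using l by blast
      then obtain r where r: "r > 0" "mball x r \<subseteq> C (l x)"
        using opn openin_mtopology by metis
      then obtain n where "(1/2)^n < r/3"
        using real_arch_pow_inv[of "r/3" "1/2"] by auto
      then have n: "mball x (3 * (1/2)^n) \<subseteq> C (l x)"
        using mball_subset_concentric[of "3 * (1/2)^n" r x] r by auto
      show "x \<in> (\<Union>n i. D n i)"
      proof (cases "x \<in> U n")
        case True
        then show ?thesis using UD by blast
      next
        case False
        then have "x \<in> cen (U n) n (l x)"
          using n \<open>x \<in> C (l x)\<close> by (simp add: cen_def)
        then have "x \<in> D n (l x)"
          unfolding D_def using subsetD[OF CM \<open>x \<in> C (l x)\<close>] by (intro UN_I[of x]) auto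
        then show ?thesis by blast
      qed
    qed
    fix x assume "x \<in> (\<Union>i. C i)"
    then obtain n i where x: "x \<in> D n i"
      using cover by blast
    have "openin mtopology (D n i)"
      unfolding D_def by blast
    then obtain e where e: "e > 0" "mball x e \<subseteq> D n i"
      using x openin_mtopology by metis
    obtain j where "(1/2)^j < e"
      using e real_arch_pow_inv[of e "1/2"] by auto
    then have j: "mball x ((1/2)^j) \<subseteq> D n i"
      using e mball_subset_concentric[of "(1/2)^j" e x] by auto
    have xM: "x \<in> M"
      using x unfolding D_def by auto
    \<comment> \<open>\<open>m \<ge> ?K\<close> forces \<open>m > n\<close> and
      \<open>m > j\<close>: centres of stage \<open>m\<close> avoid \<open>D n i\<close>, hence the
      \<open>(1/2)^j\<close>-ball about \<open>x\<close>, while both radii are at most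
      \<open>(1/2)^(j+1)\<close>. For \<open>m < ?K\<close> one has
      \<open>2 * ?r \<le> (1/2)^m\<close>.\<close>
    let ?K = "Suc (n + j)" and ?r = "(1/2)^(Suc (n + j)) :: real"
    have far: "D m k \<inter> mball x ?r = {}" if "m \<ge> ?K" for m k
    proof (rule ccontr)
      assume "D m k \<inter> mball x ?r \<noteq> {}"
      then obtain p y where p: "p \<in> mball x ?r" "y \<in> cen (U m) m k" "p \<in> mball y ((1/2)^m)"
        unfolding D_def by blast
      have "y \<notin> D n i"
        using p DU[of n m i] that unfolding cen_def by auto
      then have "d x y \<ge> (1/2)^j"
        using j p xM by (auto simp: not_less)
      moreover have "d x y \<le> d x p + d y p"
        using p xM triangle' by auto
      moreover have "(1/2)^m \<le> (1/2::real)^Suc j" "?r \<le> (1/2::real)^Suc j"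
        using that by (auto intro!: power_decreasing simp del: power_Suc)
      moreover have "d x p < ?r" "d y p < (1/2)^m" "(1/2::real)^j = 2 * (1/2)^Suc j"
        using p by auto
      ultimately show False
        by linarith
    qed
    \<comment> \<open>Two centres \<open>y\<close>, \<open>z\<close> of stage \<open>m\<close> whose
      balls meet the ball about \<open>x\<close> are less than \<open>3 * (1/2)^m\<close> apart, so
      \<open>z \<in> C k\<close> and \<open>y \<in> C k'\<close>. As \<open>k\<close> and
      \<open>k'\<close> are the first indices for \<open>y\<close> and \<open>z\<close>, each
      precedes the other.\<close>
    have unq: "k = k'" if k: "D m k \<inter> mball x ?r \<noteq> {}" "D m k' \<inter> mball x ?r \<noteq> {}" for m k k'
    proof -
      have "m < ?K"
        using far k by (meson not_less)
      then have "(1/2::real)^(n + j) \<le> (1/2)^m"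
        by (auto intro!: power_decreasing)
      then have r: "2 * ?r \<le> (1/2)^m"
        by simp
      obtain p y where p: "p \<in> mball x ?r" "y \<in> cen (U m) m k" "p \<in> mball y ((1/2)^m)"
        using k unfolding D_def by blast
      obtain q z where q: "q \<in> mball x ?r" "z \<in> cen (U m) m k'" "q \<in> mball z ((1/2)^m)"
        using k unfolding D_def by blast
      have "d y z \<le> d y p + d p x + d x q + d z q"
      proof -
        have M: "y \<in> M" "p \<in> M" "x \<in> M" "q \<in> M" "z \<in> M"
          using p q by auto
        show ?thesis
          using triangle[OF M(1,2,5)] triangle[OF M(2,3,5)] triangle[OF M(3,4,5)] commute[of q z]
          by linarith
      qed
      then have "d y z < 3 * (1/2)^m"
      proof -
        have "d x p < ?r" "d y p < (1/2)^m" "d x q < ?r" "d z q < (1/2)^m"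
          using p q by auto
        then show ?thesis
          using r commute[of p x] \<open>d y z \<le> d y p + d p x + d x q + d z q\<close> by linarith
      qed
      then have "z \<in> C k" "y \<in> C k'"
        using p q unfolding cen_def by (auto simp: commute)
      then have "(k', k) \<in> R" "(k, k') \<in> R"
        using l_le p q unfolding cen_def by auto
      then show ?thesis using anti by blast
    qed
    show "\<exists>r>0. \<exists>K. (\<forall>n\<ge>K. \<forall>i. D n i \<inter> mball x r = {}) \<and>
        (\<forall>n i j. D n i \<inter> mball x r \<noteq> {} \<longrightarrow> D n j \<inter> mball x r \<noteq> {} \<longrightarrow> i = j)"
      by (rule exI[of _ ?r]) (use far unq in \<open>auto simp del: power_Suc\<close>)
  qed
qed

subsection \<open>Distance to a set\<close>

text \<open>Inserting \<open>1\<close> keeps the infimum over a nonempty set and gives the empty set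
  distance 1. The partition of unity relies on this when the complement of a layer is empty.\<close>

definition (in Metric_space) capped_setdist :: "'a set \<Rightarrow> 'a \<Rightarrow> real" where
  "capped_setdist S x = Inf (insert 1 (d x ` S))"

context Metric_space
begin

lemma bdd_below_capped_setdist: "bdd_below (insert 1 (d x ` S))"
  by (rule bdd_belowI[of _ 0]) auto

lemma capped_setdist_nonneg: "0 \<le> capped_setdist S x"
  unfolding capped_setdist_def by (rule cInf_greatest) auto

lemma capped_setdist_le: "s \<in> S \<Longrightarrow> capped_setdist S x \<le> d x s"
  unfolding capped_setdist_def by (rule cInf_lower[OF _ bdd_below_capped_setdist]) auto

lemma capped_setdist_le_1: "capped_setdist S x \<le> 1"
  unfolding capped_setdist_def by (rule cInf_lower[OF _ bdd_below_capped_setdist]) auto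

lemma capped_setdist_eq_0: "x \<in> S \<Longrightarrow> x \<in> M \<Longrightarrow> capped_setdist S x = 0"
  using capped_setdist_nonneg[of S x] capped_setdist_le[of x S x] by simp

lemma capped_setdist_less:
  assumes "capped_setdist S x < c"
  obtains "1 < c" | s where "s \<in> S" "d x s < c"
  using assms cInf_less_iff[OF _ bdd_below_capped_setdist, of x S c]
  unfolding capped_setdist_def by auto

lemma capped_setdist_triangle:
  assumes "x \<in> M" "y \<in> M" "S \<subseteq> M"
  shows "capped_setdist S x \<le> d x y + capped_setdist S y"
proof (rule field_le_epsilon)
  fix e :: real assume "e > 0"
  then have "capped_setdist S y < capped_setdist S y + e"
    by simp
  then show "capped_setdist S x \<le> d x y + capped_setdist S y + e"
  proof (cases rule: capped_setdist_less)
    case 1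
    then show ?thesis
      using capped_setdist_le_1[of S x] nonneg[of x y] by linarith
  next
    case (2 s)
    then show ?thesis
      using capped_setdist_le[of s S x] triangle[of x y s] assms by auto
  qed
qed

lemma capped_setdist_lipschitz:
  assumes "x \<in> M" "y \<in> M" "S \<subseteq> M"
  shows "\<bar>capped_setdist S x - capped_setdist S y\<bar> \<le> d x y"
  using capped_setdist_triangle[of x y S] capped_setdist_triangle[of y x S] assms commute[of x y]
  by linarith

lemma capped_setdist_pos:
  assumes "closedin mtopology S" "x \<in> M - S"
  shows "0 < capped_setdist S x"
proof -
  have "openin mtopology (M - S)"
    using assms(1) by (simp add: closedin_def)
  then obtain r where "r > 0" "mball x r \<subseteq> M - S"
    using assms(2) openin_mtopology by metis
  moreover have "S \<subseteq> M"
    using assms(1) closedin_subset by fastforce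
  ultimately have "min r 1 \<le> capped_setdist S x"
    unfolding capped_setdist_def
  proof (intro cInf_greatest)
    fix t assume "t \<in> insert 1 (d x ` S)"
    moreover have "min r 1 \<le> d x s" if "s \<in> S" for s
    proof -
      have "s \<notin> mball x r" "s \<in> M"
        using that \<open>mball x r \<subseteq> M - S\<close> \<open>S \<subseteq> M\<close> by auto
      then show ?thesis
        using assms(2) by (simp add: min_le_iff_disj)
    qed
    ultimately show "min r 1 \<le> t"
      by auto
  qed simp
  then show ?thesis
    using \<open>r > 0\<close> by linarith
qed

end

subsection \<open>Continuous pseudometrics\<close>

text \<open>Since \<open>\<bar>D u v - D x y\<bar> \<le> D x u + D y v\<close>, smallness of
  \<open>D x\<close> near each \<open>x\<close> already yields joint continuity.\<close>

lemma CPM_I: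
  assumes "vanishes_off (topspace Z) D" and pm: "pseudometric_on (topspace Z) D"
    and small: "\<And>x e. x \<in> topspace Z \<Longrightarrow> 0 < e \<Longrightarrow> \<exists>V. openin Z V \<and> x \<in> V \<and> (\<forall>y\<in>V. D x y < e)"
  shows "D \<in> CPM Z"
proof -
  have "limitin euclideanreal (\<lambda>(x, y). D x y) (D x y) (atin (prod_topology Z Z) (x, y))"
    if xy: "x \<in> topspace Z" "y \<in> topspace Z" for x y
    unfolding limitin_canonical_iff tendsto_iff
  proof (intro allI impI)
    fix e :: real assume "e > 0"
    then obtain V W where V: "openin Z V" "x \<in> V" "\<And>u. u \<in> V \<Longrightarrow> D x u < e / 2"
      and W: "openin Z W" "y \<in> W" "\<And>v. v \<in> W \<Longrightarrow> D y v < e / 2"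
      using small[OF xy(1), of "e / 2"] small[OF xy(2), of "e / 2"] by auto
    have "dist (D u v) (D x y) < e" if "u \<in> V" "v \<in> W" for u v
    proof -
      have uv: "u \<in> topspace Z" "v \<in> topspace Z"
        using that V W openin_subset by blast+
      have "D u v \<le> D u x + D x v" "D x v \<le> D x y + D y v"
        "D x y \<le> D x u + D u y" "D u y \<le> D u v + D v y" "D u x = D x u" "D v y = D y v"
        using pm uv xy unfolding pseudometric_on_def by blast+
      then show ?thesis
        using V(3)[OF that(1)] W(3)[OF that(2)] by (simp add: dist_real_def abs_if)
    qed
    moreover have "openin (prod_topology Z Z) (V \<times> W)"
      using V W by (simp add: openin_prod_Times_iff)
    ultimately show "\<forall>\<^sub>F q in atin (prod_topology Z Z) (x, y). dist (case q of (x, y) \<Rightarrow> D x y) (D x y) < e"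
      using V W unfolding eventually_atin by (intro disjI2 exI[of _ "V \<times> W"]) auto
  qed
  then have "continuous_map (prod_topology Z Z) euclideanreal (\<lambda>(x, y). D x y)"
    unfolding continuous_map_atin by auto
  then show ?thesis
    using assms by (simp add: CPM_def)
qed

lemma CPM_small:
  assumes "d \<in> CPM Z" "x \<in> topspace Z" "0 < e"
  shows "\<exists>V. openin Z V \<and> x \<in> V \<and> (\<forall>y\<in>V. d x y < e)"
proof -
  have "continuous_map Z (prod_topology Z Z) (\<lambda>y. (x, y))"
    using assms(2) by (simp add: continuous_map_pairwise o_def)
  moreover have "continuous_map (prod_topology Z Z) euclideanreal (\<lambda>(x, y). d x y)"
    using assms(1) by (simp add: CPM_def)
  ultimately have "continuous_map Z euclideanreal ((\<lambda>(x, y). d x y) \<circ> (\<lambda>y. (x, y)))"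
    by (rule continuous_map_compose)
  then have "openin Z {y \<in> topspace Z. d x y \<in> {..<e}}"
    by (intro openin_continuous_map_preimage[where Y = euclideanreal]) (auto simp: o_def)
  moreover have "d x x = 0"
    using assms by (simp add: CPM_def pseudometric_on_def)
  ultimately show ?thesis
    using assms by (intro exI[of _ "{y \<in> topspace Z. d x y \<in> {..<e}}"]) auto
qed

text \<open>Vanishing off the carrier extends everything but the triangle inequality to the whole
  type: with only \<open>y\<close> outside, \<open>d x y + d y z\<close> is 0.\<close>

lemma
  assumes "d \<in> CPM Z"
  shows CPM_nonneg: "0 \<le> d x y" and CPM_commute: "d x y = d y x" and CPM_zero: "d x x = 0"
    and CPM_triangle: "\<lbrakk>x \<in> topspace Z; y \<in> topspace Z; z \<in> topspace Z\<rbrakk> \<Longrightarrow> d x z \<le> d x y + d y z"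
proof -
  have pm: "pseudometric_on (topspace Z) d" and off: "\<not> (x \<in> topspace Z \<and> y \<in> topspace Z) \<Longrightarrow> d x y = 0" for x y
    using assms by (auto simp: CPM_def vanishes_off_def)
  show "0 \<le> d x y" "d x y = d y x" "d x x = 0"
    using pm off[of x y] off[of y x] off[of x x] unfolding pseudometric_on_def
    by (metis order_refl)+
  show "\<lbrakk>x \<in> topspace Z; y \<in> topspace Z; z \<in> topspace Z\<rbrakk> \<Longrightarrow> d x z \<le> d x y + d y z"
    using pm unfolding pseudometric_on_def by blast
qed

lemma CPM_off: "d \<in> CPM Z \<Longrightarrow> \<not> (x \<in> topspace Z \<and> y \<in> topspace Z) \<Longrightarrow> d x y = 0"
  by (auto simp: CPM_def vanishes_off_def)

lemma Met_D:
  assumes "d \<in> Met Z"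
  shows "Metric_space (topspace Z) d" "Metric_space.mtopology (topspace Z) d = Z"
    "vanishes_off (topspace Z) d"
  using assms by (auto simp: Met_def)

lemma Met_subset_CPM: "Met Z \<subseteq> CPM Z"
proof
  fix d assume d: "d \<in> Met Z"
  interpret Metric_space "topspace Z" d
    using Met_D[OF d] by blast
  have Z: "mtopology = Z"
    using Met_D[OF d] by blast
  show "d \<in> CPM Z"
  proof (rule CPM_I)
    show "vanishes_off (topspace Z) d"
      using Met_D[OF d] by blast
    show "pseudometric_on (topspace Z) d"
      unfolding pseudometric_on_def using commute triangle by auto
    show "\<exists>V. openin Z V \<and> x \<in> V \<and> (\<forall>y\<in>V. d x y < e)" if "x \<in> topspace Z" "0 < e" for x e
      using that openin_mball[of x e] unfolding Z by (intro exI[of _ "mball x e"]) auto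
  qed
qed

text \<open>Continuity makes the balls of \<open>D\<close> neighbourhoods in \<open>Z\<close>,
  \<open>nbhd\<close> gives the converse comparison of topologies, and \<open>nbhd\<close> with T1
  separates points.\<close>

lemma Met_I:
  assumes D: "D \<in> CPM Z" and "t1_space Z"
    and nbhd: "\<And>U x. openin Z U \<Longrightarrow> x \<in> U \<Longrightarrow> \<exists>e>0. \<forall>y\<in>topspace Z. D x y < e \<longrightarrow> y \<in> U"
  shows "D \<in> Met Z"
proof -
  have eq: "x = y" if xy: "x \<in> topspace Z" "y \<in> topspace Z" "D x y = 0" for x y
  proof (rule ccontr)
    assume "x \<noteq> y"
    then obtain U where "openin Z U" "x \<in> U" "y \<notin> U"
      using \<open>t1_space Z\<close> xy unfolding t1_space_def by blast
    then show False
      using nbhd[of U x] xy by auto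
  qed
  interpret Metric_space "topspace Z" D
  proof
    show "0 \<le> D x y" "D x y = D y x" for x y
      by (rule CPM_nonneg[OF D], rule CPM_commute[OF D])
    show "D x y = 0 \<longleftrightarrow> x = y" if "x \<in> topspace Z" "y \<in> topspace Z" for x y
      using eq[OF that] CPM_zero[OF D, of x] by blast
  qed (rule CPM_triangle[OF D])
  have "openin mtopology U \<longleftrightarrow> openin Z U" for U
  proof
    assume U: "openin mtopology U"
    show "openin Z U"
    proof (subst openin_subopen, intro ballI)
      fix x assume "x \<in> U"
      then obtain r where r: "r > 0" "mball x r \<subseteq> U" "x \<in> topspace Z"
        using U openin_mtopology by (metis subsetD)
      then obtain V where V: "openin Z V" "x \<in> V" "\<forall>y\<in>V. D x y < r"
        using CPM_small[OF D r(3) r(1)] by blast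
      have "V \<subseteq> mball x r"
        using r(3) V(3) openin_subset[OF V(1)] by auto
      then have "V \<subseteq> U"
        using r(2) by blast
      then show "\<exists>T. openin Z T \<and> x \<in> T \<and> T \<subseteq> U"
        using V by blast
    qed
  next
    assume U: "openin Z U"
    have "\<exists>r>0. mball x r \<subseteq> U" if x: "x \<in> U" for x
      using nbhd[OF U x] by auto
    then show "openin mtopology U"
      using openin_subset[OF U] openin_mtopology by simp
  qed
  then have "mtopology = Z"
    by (simp add: topology_eq)
  then show ?thesis
    using D Metric_space_axioms by (simp add: Met_def CPM_def)
qed

section \<open>Truncating metrics to a subset; a Cauchy criterion\<close>

context Metric_space
begin

lemma Metric_space_restrict2: "Metric_space M (restrict2 d M)"
  by unfold_locales (simp_all add: restrict2_def commute triangle)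

lemma mtopology_restrict2: "Metric_space.mtopology M (restrict2 d M) = mtopology"
proof -
  interpret R: Metric_space M "restrict2 d M"
    by (rule Metric_space_restrict2)
  have "R.mball x r = mball x r" for x r
    unfolding R.mball_def mball_def by (auto simp: restrict2_def)
  then show ?thesis
    unfolding R.mtopology_def mtopology_def R.mopen_def mopen_def by simp
qed

lemma mcomplete_restrict2: "Metric_space.mcomplete M (restrict2 d M) \<longleftrightarrow> mcomplete"
proof -
  interpret R: Metric_space M "restrict2 d M"
    by (rule Metric_space_restrict2)
  have "restrict2 d M (s m) (s n) = d (s m) (s n)" if "range s \<subseteq> M" for s :: "nat \<Rightarrow> 'a" and m n
    using that by (auto simp: restrict2_def)
  then have "R.MCauchy s \<longleftrightarrow> MCauchy s" for s
    unfolding R.MCauchy_def MCauchy_def by (simp cong: conj_cong)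
  then show ?thesis
    unfolding R.mcomplete_def mcomplete_def mtopology_restrict2 by simp
qed

end

text \<open>This recognises metrics in the range of the pseudometric extensor: if \<open>E d\<close>
  is a metric for \<open>X\<close>, its restriction \<open>d\<close> is one for
  \<open>A\<close>.\<close>

lemma restrict2_Met:
  assumes d: "d \<in> Met X" and A: "A \<subseteq> topspace X"
  shows "restrict2 d A \<in> Met (subtopology X A)"
proof -
  interpret Submetric "topspace X" d A
    using Met_D[OF d] A by (simp add: Submetric_def Submetric_axioms_def)
  have "topspace (subtopology X A) = A"
    using A by auto
  moreover have "Metric_space.mtopology A (restrict2 d A) = subtopology X A"
    using sub.mtopology_restrict2 mtopology_submetric Met_D(2)[OF d] by simp
  ultimately show ?thesis
    using sub.Metric_space_restrict2 unfolding Met_def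
    by (simp add: vanishes_off_def) (simp add: restrict2_def)
qed

lemma (in Metric_space) MCauchy_if_summable:
  assumes u: "range u \<subseteq> M" and sm: "summable (\<lambda>k. d (u k) (u (Suc k)))"
  shows "MCauchy u"
  unfolding MCauchy_def
proof (intro conjI allI impI u)
  fix e :: real assume "e > 0"
  define S where "S = (\<lambda>n. \<Sum>k<n. d (u k) (u (Suc k)))"
  have uM: "u k \<in> M" for k
    using u by blast
  have mono: "d (u m) (u n) \<le> S n - S m" if "m \<le> n" for m n
    using that
  proof (induction n rule: dec_induct)
    case base
    then show ?case using uM by simp
  next
    case (step n)
    then show ?case
      using triangle[OF uM[of m] uM[of n] uM[of "Suc n"]] by (simp add: S_def)
  qed
  have "Cauchy S"
    using sm unfolding S_def by (simp add: summable_iff_convergent convergent_Cauchy)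
  then obtain N where N: "\<And>m n. m \<ge> N \<Longrightarrow> n \<ge> N \<Longrightarrow> \<bar>S m - S n\<bar> < e"
    using \<open>e > 0\<close> unfolding Cauchy_def dist_real_def by meson
  have "d (u m) (u n) < e" if "m \<ge> N" "n \<ge> N" for m n
    using mono[of m n] mono[of n m] N[OF that] commute[of "u m" "u n"] by (cases "m \<le> n") auto
  then show "\<exists>N. \<forall>n n'. N \<le> n \<longrightarrow> N \<le> n' \<longrightarrow> d (u n) (u n') < e"
    by blast
qed

subsection \<open>Extension along a random retraction\<close>

text \<open>Finite range (\<open>f_simple\<close>) makes \<open>d (f w x) (f w y)\<close> integrable
  for every \<open>d\<close>, with no sigma-algebra on the points. A finite range common to all
  points near \<open>x\<close> (\<open>f_finite\<close>) bounds \<open>d\<close> there, so that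
  continuity in probability (\<open>f_cont\<close>) becomes continuity of averages.\<close>

locale random_retraction = Metric_space M \<rho> for M :: "'a set" and \<rho> +
  fixes A :: "'a set" and P :: "'w measure" and f :: "'w \<Rightarrow> 'a \<Rightarrow> 'a"
  assumes closed: "closedin mtopology A"
    and prob: "emeasure P (space P) = 1"
    and f_in: "\<And>w x. w \<in> space P \<Longrightarrow> x \<in> M \<Longrightarrow> f w x \<in> A"
    and f_id: "\<And>w x. x \<in> A \<Longrightarrow> f w x = x"
    and f_near: "\<And>w x. w \<in> space P \<Longrightarrow> x \<in> M \<Longrightarrow> \<rho> x (f w x) \<le> 3 * capped_setdist A x"
    and f_simple: "\<And>x. x \<in> M \<Longrightarrow> simple_function P (\<lambda>w. f w x)"
    and f_finite: "\<And>x. x \<in> M - A \<Longrightarrow>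
        \<exists>F r. finite F \<and> r > 0 \<and> (\<forall>y\<in>mball x r. \<forall>w\<in>space P. f w y \<in> F)"
    and f_cont: "\<And>x e. x \<in> M - A \<Longrightarrow> e > 0 \<Longrightarrow>
        \<exists>r>0. \<forall>y\<in>mball x r. measure P {w \<in> space P. f w y \<noteq> f w x} < e"
begin

sublocale finite_measure P
  by (rule finite_measureI) (simp add: prob)

abbreviation \<sigma> :: "'a \<Rightarrow> real" where "\<sigma> \<equiv> capped_setdist A"

abbreviation "XA \<equiv> subtopology mtopology A"

definition mean_dist :: "('a \<Rightarrow> 'a \<Rightarrow> real) \<Rightarrow> 'a \<Rightarrow> 'a \<Rightarrow> real" where
  "mean_dist d x y = (\<integral>w. d (f w x) (f w y) \<partial>P)"

text \<open>The distance after shrinking \<open>A\<close> to a point: the way from \<open>x\<close>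
  to \<open>y\<close> is direct or passes through \<open>A\<close>, where travel is free.\<close>

definition collapsed_dist :: "'a \<Rightarrow> 'a \<Rightarrow> real" where
  "collapsed_dist x y = min (\<rho> x y) (\<sigma> x + \<sigma> y)"

definition extend :: "('a \<Rightarrow> 'a \<Rightarrow> real) \<Rightarrow> 'a \<Rightarrow> 'a \<Rightarrow> real" where
  "extend d x y = (if x \<in> M \<and> y \<in> M then mean_dist d x y + collapsed_dist x y else 0)"

section \<open>The averaged term and the collapsed term\<close>

lemma A_subset: "A \<subseteq> M"
  using closed closedin_subset by fastforce

lemma A_in_M: "x \<in> A \<Longrightarrow> x \<in> M"
  using A_subset by blast

lemma topspace_XA: "topspace XA = A"
  using A_subset by auto

lemma prob_space_eq: "measure P (space P) = 1"
  using prob by (simp add: measure_def)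

lemma sigma_nonneg: "0 \<le> \<sigma> x"
  by (rule capped_setdist_nonneg)

lemma sigma_zero: "x \<in> A \<Longrightarrow> \<sigma> x = 0"
  using capped_setdist_eq_0 A_subset by blast

lemma sigma_pos: "x \<in> M - A \<Longrightarrow> 0 < \<sigma> x"
  by (rule capped_setdist_pos[OF closed])

lemma sigma_triangle: "x \<in> M \<Longrightarrow> y \<in> M \<Longrightarrow> \<sigma> x \<le> \<rho> x y + \<sigma> y"
  using capped_setdist_triangle A_subset by blast

lemma collapsed_dist_nonneg: "0 \<le> collapsed_dist x y"
  using sigma_nonneg[of x] sigma_nonneg[of y] by (simp add: collapsed_dist_def)

lemma collapsed_dist_le: "collapsed_dist x y \<le> \<rho> x y"
  by (simp add: collapsed_dist_def)

lemma collapsed_dist_commute: "collapsed_dist x y = collapsed_dist y x"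
  by (simp add: collapsed_dist_def commute add.commute)

lemma collapsed_dist_triangle:
  assumes "x \<in> M" "y \<in> M" "z \<in> M"
  shows "collapsed_dist x z \<le> collapsed_dist x y + collapsed_dist y z"
  using assms triangle[of x y z] sigma_triangle[of x y] sigma_triangle[of z y]
    sigma_nonneg[of y] commute[of y z]
  unfolding collapsed_dist_def min_def by (simp split: if_splits)

lemma collapsed_dist_A: "x \<in> A \<Longrightarrow> y \<in> A \<Longrightarrow> collapsed_dist x y = 0"
  by (simp add: collapsed_dist_def sigma_zero)

text \<open>A passage through \<open>A\<close> costs at least \<open>\<sigma> y\<close>, so \<sigma>
  stays 1-Lipschitz. This is how small values of the extension control \<sigma>.\<close>

lemma sigma_le_collapsed_dist:
  assumes "x \<in> M" "y \<in> M"
  shows "\<sigma> y \<le> \<sigma> x + collapsed_dist x y"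
  using sigma_triangle[of y x] assms sigma_nonneg[of x] commute[of x y]
  by (simp add: collapsed_dist_def)

lemma integrable_mean_dist:
  assumes "x \<in> M" "y \<in> M"
  shows "integrable P (\<lambda>w. (d (f w x) (f w y) :: real))"
proof -
  have sf: "simple_function P (\<lambda>w. d (f w x) (f w y))"
    using f_simple[OF assms(1)] f_simple[OF assms(2)] by (rule simple_function_compose2)
  then have "finite (abs ` (\<lambda>w. d (f w x) (f w y)) ` space P)"
    by (intro finite_imageI simple_functionD(1))
  then obtain B where "\<forall>b\<in>abs ` (\<lambda>w. d (f w x) (f w y)) ` space P. b \<le> B"
    using bdd_above_finite unfolding bdd_above_def by blast
  then have "\<And>w. w \<in> space P \<Longrightarrow> \<bar>d (f w x) (f w y)\<bar> \<le> B"
    by simp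
  then show ?thesis
    using borel_measurable_simple_function[OF sf]
    by (intro integrable_const_bound[of _ B]) auto
qed

lemma mean_dist_le:
  assumes "x \<in> M" "y \<in> M" "\<And>w. w \<in> space P \<Longrightarrow> d (f w x) (f w y) \<le> c"
  shows "mean_dist d x y \<le> c"
proof -
  have "mean_dist d x y \<le> (\<integral>w. c \<partial>P)"
    unfolding mean_dist_def
    by (intro integral_mono integrable_mean_dist[OF assms(1,2)] assms(3)) auto
  then show ?thesis
    by (simp add: prob_space_eq)
qed

text \<open>As the total mass is 1, not every sample can lie above the average. Closeness under
  \<open>extend d\<close> thus descends to closeness in \<open>A\<close> for a single
  \<open>w\<close>.\<close>

lemma mean_dist_less:
  assumes "x \<in> M" "y \<in> M" "mean_dist d x y < c"
  obtains w where "w \<in> space P" "d (f w x) (f w y) < c"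
proof -
  have "\<exists>w\<in>space P. d (f w x) (f w y) < c"
  proof (rule ccontr)
    assume "\<not> ?thesis"
    then have "(\<integral>w. c \<partial>P) \<le> mean_dist d x y"
      unfolding mean_dist_def
      by (intro integral_mono integrable_mean_dist[OF assms(1,2)]) (auto simp: not_less)
    then show False
      using assms by (simp add: prob_space_eq)
  qed
  then show ?thesis using that by blast
qed

lemma mean_dist_A:
  assumes "x \<in> A" "y \<in> A"
  shows "mean_dist d x y = d x y"
  unfolding mean_dist_def using assms by (simp add: f_id prob_space_eq)

lemma mean_dist_nonneg: "d \<in> CPM Z \<Longrightarrow> 0 \<le> mean_dist d x y"
  unfolding mean_dist_def by (intro Bochner_Integration.integral_nonneg) (simp add: CPM_nonneg)

lemma mean_dist_triangle:
  assumes d: "d \<in> CPM XA" and xyz: "x \<in> M" "y \<in> M" "z \<in> M"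
  shows "mean_dist d x z \<le> mean_dist d x y + mean_dist d y z"
proof -
  have "mean_dist d x z \<le> (\<integral>w. d (f w x) (f w y) + d (f w y) (f w z) \<partial>P)"
    unfolding mean_dist_def
    by (intro integral_mono integrable_mean_dist Bochner_Integration.integrable_add CPM_triangle[OF d])
      (auto simp: xyz topspace_XA[simplified] f_in A_in_M)
  then show ?thesis
    unfolding mean_dist_def using xyz by (simp add: integrable_mean_dist)
qed

lemma mean_dist_commute: "d \<in> CPM Z \<Longrightarrow> mean_dist d x y = mean_dist d y x"
  unfolding mean_dist_def by (rule Bochner_Integration.integral_cong[OF refl CPM_commute])

lemma extend_commute: "d \<in> CPM Z \<Longrightarrow> extend d x y = extend d y x"
  unfolding extend_def using mean_dist_commute[of d Z x y] collapsed_dist_commute[of x y] by auto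

text \<open>For \<open>x\<close> in \<open>A\<close>, \<open>\<rho> x (f w y) \<le> \<rho> x y + 3 *
  \<sigma> y \<le> 4 * \<rho> x y\<close>, so all samples stay near \<open>x\<close>. Off
  \<open>A\<close>, \<open>f w y\<close> and \<open>f w x\<close> agree up to small probability, and
  \<open>d\<close> is bounded on their finitely many values.\<close>

lemma mean_dist_small:
  assumes d: "d \<in> CPM XA" and x: "x \<in> M" and e: "0 < e"
  shows "\<exists>r>0. \<forall>y\<in>mball x r. mean_dist d x y < e"
proof (cases "x \<in> A")
  case True
  then obtain V where V: "openin XA V" "x \<in> V" "\<And>y. y \<in> V \<Longrightarrow> d x y < e / 2"
    using CPM_small[OF d, of x "e / 2"] e unfolding topspace_XA by auto
  then obtain U where U: "openin mtopology U" "V = U \<inter> A"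
    unfolding openin_subtopology by blast
  then obtain r where r: "r > 0" "mball x r \<subseteq> U"
    using V(2) openin_mtopology by (metis IntD1)
  have "mean_dist d x y \<le> e / 2" if y: "y \<in> mball x (r / 4)" for y
  proof (rule mean_dist_le)
    show yM: "x \<in> M" "y \<in> M"
      using y by auto
    fix w assume w: "w \<in> space P"
    have fw: "f w y \<in> A" "f w y \<in> M"
      using f_in[OF w yM(2)] A_subset by auto
    have "\<rho> x (f w y) \<le> \<rho> x y + \<rho> y (f w y)"
      using triangle yM fw by blast
    also have "\<dots> \<le> \<rho> x y + 3 * \<sigma> y"
      using f_near[OF w yM(2)] by simp
    also have "\<dots> \<le> 4 * \<rho> x y"
      using sigma_triangle[OF yM(2,1)] sigma_zero[OF True] commute[of x y] by simp
    also have "\<dots> < r"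
      using y by simp
    finally have "f w y \<in> V"
      using U r fw yM by auto
    then show "d (f w x) (f w y) \<le> e / 2"
      using V(3) f_id[OF True] by (simp add: less_imp_le)
  qed
  then show ?thesis
    using r e by (intro exI[of _ "r / 4"]) force
next
  case False
  then have x: "x \<in> M - A"
    using x by simp
  obtain F r where F: "finite F" "r > 0" "\<forall>y\<in>mball x r. \<forall>w\<in>space P. f w y \<in> F"
    using f_finite[OF x] by blast
  \<comment> \<open>The sum dominates every value of \<open>d\<close> on
    \<open>F \<times> F\<close>; the added 1 makes \<open>C\<close> positive, so
    \<open>e / C\<close> can be asked of \<open>f_cont\<close>.\<close>
  define C where "C = (\<Sum>(a, b)\<in>F \<times> F. d a b) + 1"
  have "0 \<le> (\<Sum>(a, b)\<in>F \<times> F. d a b)"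
    using CPM_nonneg[OF d] by (auto intro!: sum_nonneg)
  then have C: "C > 0"
    by (simp add: C_def)
  have dC: "d a b \<le> C" if "a \<in> F" "b \<in> F" for a b
  proof -
    have "(case (a, b) of (a, b) \<Rightarrow> d a b) \<le> (\<Sum>(a, b)\<in>F \<times> F. d a b)"
      using F that CPM_nonneg[OF d] by (intro member_le_sum) auto
    then show ?thesis by (simp add: C_def)
  qed
  obtain s where s: "s > 0" "\<forall>y\<in>mball x s. measure P {w \<in> space P. f w y \<noteq> f w x} < e / C"
    using f_cont[OF x, of "e / C"] C e by auto
  have "mean_dist d x y < e" if y: "y \<in> mball x (min r s)" for y
  proof -
    have yM: "x \<in> M" "y \<in> M" and ys: "y \<in> mball x s" and yr: "y \<in> mball x r" and xr: "x \<in> mball x r"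
      using y F(2) by auto
    let ?B = "{w \<in> space P. f w y \<noteq> f w x}"
    \<comment> \<open>The event \<open>?B\<close> is measurable as a preimage under a simple
      function of \<open>w\<close>.\<close>
    have "simple_function P (\<lambda>w. f w y \<noteq> f w x)"
      using f_simple[OF yM(2)] f_simple[OF yM(1)] by (rule simple_function_compose2)
    then have "(\<lambda>w. f w y \<noteq> f w x) -` {True} \<inter> space P \<in> sets P"
      by (rule simple_functionD(2))
    moreover have "(\<lambda>w. f w y \<noteq> f w x) -` {True} \<inter> space P = ?B"
      by auto
    ultimately have B: "?B \<in> sets P" by simp
    have "mean_dist d x y \<le> (\<integral>w. C * indicator ?B w \<partial>P)"
      unfolding mean_dist_def
    proof (intro integral_mono integrable_mean_dist yM)
      show "integrable P (\<lambda>w. C * indicator ?B w)"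
        using B by (intro integrable_mult_right integrable_real_indicator) (auto simp: less_top[symmetric])
      fix w assume "w \<in> space P"
      then show "d (f w x) (f w y) \<le> C * indicator ?B w"
        using dC F(3) xr yr CPM_zero[OF d] by (auto simp: indicator_def)
    qed
    also have "\<dots> = C * measure P ?B"
      using B by (simp add: Int_absorb1)
    also have "\<dots> < e"
      using s(2) ys C by (simp add: field_simps)
    finally show ?thesis .
  qed
  then show ?thesis
    using F(2) s(1) by (intro exI[of _ "min r s"]) auto
qed

section \<open>Isometric extension of pseudometrics\<close>

lemma extend_CPM:
  assumes d: "d \<in> CPM XA"
  shows "extend d \<in> CPM mtopology"
proof (rule CPM_I; unfold topspace_mtopology)
  show "vanishes_off M (extend d)"
    by (auto simp: vanishes_off_def extend_def)
  show "pseudometric_on M (extend d)"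
    unfolding pseudometric_on_def
  proof (intro conjI ballI)
    fix x y assume xy: "x \<in> M" "y \<in> M"
    show "0 \<le> extend d x y"
      using mean_dist_nonneg[OF d] collapsed_dist_nonneg by (simp add: extend_def)
    show "extend d x y = extend d y x"
      by (rule extend_commute[OF d])
    show "extend d x x = 0"
      using sigma_nonneg[of x] xy by (simp add: extend_def mean_dist_def CPM_zero[OF d] collapsed_dist_def)
    fix z assume "z \<in> M"
    then show "extend d x z \<le> extend d x y + extend d y z"
      using mean_dist_triangle[OF d xy] collapsed_dist_triangle[OF xy] xy by (simp add: extend_def add_mono)
        (smt (verit))
  qed
  fix x and e :: real assume x: "x \<in> M" and e: "0 < e"
  then obtain r where r: "r > 0" "\<forall>y\<in>mball x r. mean_dist d x y < e / 2"
    using mean_dist_small[OF d, of x "e / 2"] by auto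
  have "extend d x y < e" if y: "y \<in> mball x (min r (e / 2))" for y
  proof -
    have "mean_dist d x y < e / 2"
      using r(2) y by auto
    moreover have "collapsed_dist x y < e / 2"
      using collapsed_dist_le[of x y] y by auto
    ultimately show ?thesis
      using y by (simp add: extend_def)
  qed
  then show "\<exists>V. openin mtopology V \<and> x \<in> V \<and> (\<forall>y\<in>V. extend d x y < e)"
    using x r e by (intro exI[of _ "mball x (min r (e / 2))"]) auto
qed

lemma restrict2_extend:
  assumes d: "d \<in> CPM XA"
  shows "restrict2 (extend d) A = d"
proof (intro ext)
  fix x y
  show "restrict2 (extend d) A x y = d x y"
    using CPM_off[OF d, of x y] unfolding topspace_XA
    by (auto simp: restrict2_def extend_def mean_dist_A collapsed_dist_A A_in_M)
qed

lemma extend_eq_on_A: "d \<in> CPM XA \<Longrightarrow> x \<in> A \<Longrightarrow> y \<in> A \<Longrightarrow> extend d x y = d x y"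
  using A_in_M by (simp add: extend_def mean_dist_A collapsed_dist_A)

lemma sup_dist_extend:
  assumes d: "d \<in> CPM XA" and e: "e \<in> CPM XA"
  shows "sup_dist mtopology (extend d) (extend e) = sup_dist XA d e"
proof (rule antisym)
  show "sup_dist XA d e \<le> sup_dist mtopology (extend d) (extend e)"
    unfolding sup_dist_def topspace_XA topspace_mtopology
    using A_subset by (intro SUP_mono) (force simp: extend_eq_on_A d e)
  show "sup_dist mtopology (extend d) (extend e) \<le> sup_dist XA d e"
  \<comment> \<open>An infinite supremum bounds everything; otherwise it is a real \<open>c\<close>,
    and the real integral bounds the averaged difference, once for each sign.\<close>
  proof (cases "sup_dist XA d e")
    case top
    then show ?thesis by simp
  next
    case (real c)
    have de: "\<bar>d a b - e a b\<bar> \<le> c" if "a \<in> A" "b \<in> A" for a b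
    proof -
      have "ennreal \<bar>d a b - e a b\<bar> \<le> sup_dist XA d e"
        unfolding sup_dist_def topspace_XA using that by (intro SUP_upper2[of "(a, b)"]) auto
      then show ?thesis
        using real by simp
    qed
    have "\<bar>extend d x y - extend e x y\<bar> \<le> c" if xy: "x \<in> M" "y \<in> M" for x y
    proof -
      have "mean_dist d x y - mean_dist e x y = mean_dist (\<lambda>a b. d a b - e a b) x y"
        "mean_dist e x y - mean_dist d x y = mean_dist (\<lambda>a b. e a b - d a b) x y"
        unfolding mean_dist_def using xy by (simp_all add: integrable_mean_dist)
      moreover have "mean_dist (\<lambda>a b. d a b - e a b) x y \<le> c" "mean_dist (\<lambda>a b. e a b - d a b) x y \<le> c"
        using de f_in xy by (intro mean_dist_le; force simp: abs_le_iff)+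
      ultimately show ?thesis
        using xy by (simp add: extend_def abs_le_iff)
    qed
    then have "sup_dist mtopology (extend d) (extend e) \<le> ennreal c"
      unfolding sup_dist_def topspace_mtopology by (intro SUP_least) (auto simp: ennreal_leI)
    then show ?thesis
      using real by simp
  qed
qed

section \<open>Metrics, bounded metrics, complete metrics\<close>

lemma extend_Met:
  assumes d: "d \<in> Met XA"
  shows "extend d \<in> Met mtopology"
proof (rule Met_I)
  have dC: "d \<in> CPM XA"
    using d Met_subset_CPM by blast
  then show "extend d \<in> CPM mtopology"
    by (rule extend_CPM)
  show "t1_space mtopology"
    by (simp add: Hausdorff_imp_t1_space Hausdorff_space_mtopology)
  fix U x assume "openin mtopology U" and xU: "x \<in> U"
  then obtain r where r: "r > 0" "mball x r \<subseteq> U" and x: "x \<in> M"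
    using openin_mtopology by (metis subsetD)
  have key: "\<exists>e>0. \<forall>y\<in>M. extend d x y < e \<longrightarrow> \<rho> x y < r"
  proof (cases "x \<in> A")
    case False
    then have s: "\<sigma> x > 0"
      using sigma_pos x by blast
    \<comment> \<open>Below \<open>\<sigma> x\<close> the minimum in \<open>collapsed_dist\<close>
      cannot be \<open>\<sigma> x + \<sigma> y\<close>, so it is \<open>\<rho> x y\<close>.\<close>
    have "\<rho> x y < r" if "y \<in> M" "extend d x y < min r (\<sigma> x)" for y
      using that x mean_dist_nonneg[OF dC, of x y] sigma_nonneg[of y]
      by (auto simp: extend_def collapsed_dist_def min_def split: if_splits)
    then show ?thesis
      using s r by (intro exI[of _ "min r (\<sigma> x)"]) auto
  next
    case True
    interpret D: Metric_space A d
      using Met_D(1)[OF d] unfolding topspace_XA .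
    have "openin XA (A \<inter> mball x (r / 2))"
      by (rule openin_subtopology_Int2) simp
    then have "openin D.mtopology (A \<inter> mball x (r / 2))"
      using Met_D(2)[OF d] unfolding topspace_XA by simp
    then obtain s where s: "s > 0" "D.mball x s \<subseteq> A \<inter> mball x (r / 2)"
      using True x r unfolding D.openin_mtopology by auto
    \<comment> \<open>The first term below \<open>s\<close> gives a sample with \<open>f w y\<close>
      within \<open>r / 2\<close> of \<open>x\<close>; the second below \<open>r / 6\<close> gives
      \<open>3 * \<sigma> y < r / 2\<close>, the distance from \<open>y\<close> to
      \<open>f w y\<close>.\<close>
    have "\<rho> x y < r" if y: "y \<in> M" "extend d x y < min s (r / 6)" for y
    proof -
      have m: "mean_dist d x y < s"
        using y x collapsed_dist_nonneg[of x y] by (simp add: extend_def)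
      have c: "collapsed_dist x y < r / 6"
        using y x mean_dist_nonneg[OF dC, of x y] by (simp add: extend_def)
      then have sy: "\<sigma> y < r / 6"
        using sigma_le_collapsed_dist[OF x y(1)] sigma_zero[OF True] by simp
      obtain w where w: "w \<in> space P" "d (f w x) (f w y) < s"
        using mean_dist_less[OF x y(1) m] .
      have fw: "f w y \<in> A" "f w y \<in> M"
        using f_in[OF w(1) y(1)] A_subset by auto
      then have "f w y \<in> D.mball x s"
        using w(2) f_id[OF True] True by simp
      then have "\<rho> x (f w y) < r / 2"
        using s(2) by auto
      moreover have "\<rho> x y \<le> \<rho> x (f w y) + \<rho> y (f w y)"
        using triangle'[OF x fw(2) y(1)] .
      ultimately show ?thesis
        using f_near[OF w(1) y(1)] sy by simp
    qed
    then show ?thesis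
      using s r by (intro exI[of _ "min s (r / 6)"]) auto
  qed
  then show "\<exists>e>0. \<forall>y\<in>topspace mtopology. extend d x y < e \<longrightarrow> y \<in> U"
    using r(2) x unfolding topspace_mtopology by (meson in_mball subsetD)
qed

lemma extend_BMet:
  assumes bdd: "\<And>x y. x \<in> M \<Longrightarrow> y \<in> M \<Longrightarrow> \<rho> x y \<le> 1" and d: "d \<in> BMet XA"
  shows "extend d \<in> BMet mtopology"
proof -
  have dM: "d \<in> Met XA"
    using d by (simp add: BMet_def)
  have E: "extend d \<in> Met mtopology"
    by (rule extend_Met[OF dM])
  interpret D: Metric_space A d
    using Met_D(1)[OF dM] unfolding topspace_XA .
  interpret E: Metric_space M "extend d"
    using Met_D(1)[OF E] by simp
  have "D.mbounded A"
    using d unfolding BMet_def topspace_XA by simp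
  then obtain B where B: "\<And>a b. a \<in> A \<Longrightarrow> b \<in> A \<Longrightarrow> d a b \<le> B"
    unfolding D.mbounded_alt by blast
  have "extend d x y \<le> B + 1" if xy: "x \<in> M" "y \<in> M" for x y
  proof -
    have "mean_dist d x y \<le> B"
      using xy by (intro mean_dist_le B f_in)
    moreover have "collapsed_dist x y \<le> 1"
      using collapsed_dist_le[of x y] bdd[OF xy] by simp
    ultimately show ?thesis
      using xy by (simp add: extend_def)
  qed
  then have "E.mbounded M"
    unfolding E.mbounded_alt by blast
  then show ?thesis
    using E by (simp add: BMet_def)
qed

text \<open>One late term with \<open>c \<le> \<sigma>\<close> keeps \<sigma> above
  \<open>c / 2\<close> at all late terms, by the Lipschitz property of \<sigma>. Below
  \<open>c / 2\<close>, \<open>collapsed_dist\<close> then equals \<rho>, so the sequence is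
  \<rho>-Cauchy.\<close>

lemma extend_MCauchy_away:
  fixes s :: "nat \<Rightarrow> 'a"
  assumes complete: "mcomplete" and d: "d \<in> CPM XA"
    and sM: "range s \<subseteq> M"
    and cauchy: "\<And>e. 0 < e \<Longrightarrow> \<exists>N. \<forall>m\<ge>N. \<forall>n\<ge>N. extend d (s m) (s n) < e"
    and c: "0 < c" "\<And>N. \<exists>n\<ge>N. c \<le> \<sigma> (s n)"
  shows "\<exists>x. limitin mtopology s x sequentially"
proof -
  have sM: "s n \<in> M" for n
    using sM by blast
  have collapsed: "\<exists>N. \<forall>m\<ge>N. \<forall>n\<ge>N. collapsed_dist (s m) (s n) < e" if "0 < e" for e
  proof -
    have "collapsed_dist (s m) (s n) \<le> extend d (s m) (s n)" for m n
      using mean_dist_nonneg[OF d] sM by (simp add: extend_def)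
    then show ?thesis
      using cauchy[OF that] by (meson order_le_less_trans)
  qed
  obtain N where N: "\<forall>m\<ge>N. \<forall>n\<ge>N. collapsed_dist (s m) (s n) < c / 2"
    using collapsed[of "c / 2"] c(1) by auto
  obtain k where k: "k \<ge> N" "c \<le> \<sigma> (s k)"
    using c(2) by blast
  have far: "c / 2 < \<sigma> (s n)" if "n \<ge> N" for n
  proof -
    have "collapsed_dist (s n) (s k) < c / 2"
      using N k(1) that by blast
    then show ?thesis
      using sigma_le_collapsed_dist[OF sM sM, of k n] k(2) by linarith
  qed
  have "MCauchy s"
    unfolding MCauchy_def
  proof (intro conjI allI impI)
    show "range s \<subseteq> M"
      using sM by blast
    fix e :: real assume "e > 0"
    then obtain N' where N': "\<forall>m\<ge>N'. \<forall>n\<ge>N'. collapsed_dist (s m) (s n) < min e (c / 2)"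
      using collapsed[of "min e (c / 2)"] c(1) by auto
    have "\<rho> (s m) (s n) < e" if "m \<ge> max N N'" "n \<ge> max N N'" for m n
    proof -
      have "collapsed_dist (s m) (s n) < min e (c / 2)"
        using N' that by simp
      then show ?thesis
        using far[of m] that sigma_nonneg[of "s n"]
        unfolding collapsed_dist_def by (simp add: min_def split: if_splits)
    qed
    then show "\<exists>N. \<forall>n n'. N \<le> n \<longrightarrow> N \<le> n' \<longrightarrow> \<rho> (s n) (s n') < e"
      by blast
  qed
  then show ?thesis
    using complete unfolding mcomplete_def by blast
qed

text \<open>Along a subsequence with summable consecutive distances, monotone convergence yields one
  sample point \<open>w\<close> whose trace \<open>f w\<close> is Cauchy in \<open>A\<close>; its limit attracts the sequence.\<close>

lemma extend_MCauchy_near: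
  fixes s :: "nat \<Rightarrow> 'a"
  assumes d: "d \<in> Comp XA" and sM: "range s \<subseteq> M"
    and cauchy: "\<And>e. 0 < e \<Longrightarrow> \<exists>N. \<forall>m\<ge>N. \<forall>n\<ge>N. extend d (s m) (s n) < e"
    and near: "\<And>c. 0 < c \<Longrightarrow> \<exists>N. \<forall>n\<ge>N. \<sigma> (s n) < c"
  shows "\<exists>x r. strict_mono r \<and> limitin mtopology (s \<circ> r) x sequentially"
proof -
  have dM: "d \<in> Met XA"
    using d by (simp add: Comp_def)
  then have dC: "d \<in> CPM XA"
    using Met_subset_CPM by blast
  interpret D: Metric_space A d
    using Met_D(1)[OF dM] unfolding topspace_XA .
  have D_top: "D.mtopology = XA"
    using Met_D(2)[OF dM] unfolding topspace_XA .
  have D_complete: "D.mcomplete"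
    using d unfolding Comp_def topspace_XA by simp
  have sM: "s n \<in> M" for n
    using sM by blast
  have "\<forall>k. \<exists>N. \<forall>m\<ge>N. \<forall>n\<ge>N. extend d (s m) (s n) < (1/2)^k"
    using cauchy by simp
  then obtain N where N: "\<And>k m n. m \<ge> N k \<Longrightarrow> n \<ge> N k \<Longrightarrow> extend d (s m) (s n) < (1/2)^k"
    by metis
  \<comment> \<open>Summing \<open>Suc (N i)\<close> makes \<open>r\<close> strictly increasing and
    keeps \<open>r k \<ge> N k\<close>.\<close>
  define r where "r = (\<lambda>k. \<Sum>i\<le>k. Suc (N i))"
  have r: "strict_mono r"
    by (simp add: strict_mono_Suc_iff r_def)
  have rN: "r k \<ge> N k" for k
    using member_le_sum[of k "{..k}" "\<lambda>i. Suc (N i)"] by (simp add: r_def)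
  have small: "mean_dist d (s (r k)) (s (r (Suc k))) \<le> (1/2)^k" for k
  proof -
    have "r (Suc k) \<ge> N k"
      using rN[of k] strict_mono_less[OF r, of k "Suc k"] by simp
    then have "extend d (s (r k)) (s (r (Suc k))) < (1/2)^k"
      using N rN by blast
    then show ?thesis
      using sM collapsed_dist_nonneg[of "s (r k)" "s (r (Suc k))"] by (simp add: extend_def)
  qed
  let ?t = "\<lambda>k w. d (f w (s (r k))) (f w (s (r (Suc k))))"
  have int: "integrable P (?t k)" for k
    using sM by (intro integrable_mean_dist)
  then have meas: "(\<lambda>w. ennreal (?t k w)) \<in> borel_measurable P" for k
    by measurable
  have "(\<integral>\<^sup>+w. (\<Sum>k. ennreal (?t k w)) \<partial>P) = (\<Sum>k. \<integral>\<^sup>+w. ennreal (?t k w) \<partial>P)"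
    by (rule nn_integral_suminf[OF meas])
  also have "\<dots> = (\<Sum>k. ennreal (mean_dist d (s (r k)) (s (r (Suc k)))))"
    unfolding mean_dist_def by (intro suminf_cong nn_integral_eq_integral int) (simp add: CPM_nonneg[OF dC])
  also have "\<dots> \<le> (\<Sum>k. ennreal ((1/2)^k))"
    using small by (intro suminf_le) (auto simp: ennreal_leI)
  also have "\<dots> < top"
    unfolding less_top[symmetric] by (intro ennreal_suminf_neq_top summable_geometric) auto
  finally have "(\<integral>\<^sup>+w. (\<Sum>k. ennreal (?t k w)) \<partial>P) \<noteq> \<infinity>"
    by simp
  then have "AE w in P. (\<Sum>k. ennreal (?t k w)) \<noteq> \<infinity>"
    using meas by (intro nn_integral_PInf_AE borel_measurable_suminf_order) auto
  \<comment> \<open>Positive total mass: a property holding almost everywhere holds at some sample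
    point.\<close>
  moreover have "ae_filter P \<noteq> bot"
    using prob by (simp add: ae_filter_eq_bot_iff)
  ultimately obtain w where w: "w \<in> space P" "(\<Sum>k. ennreal (?t k w)) \<noteq> \<infinity>"
    using eventually_happens'[of "ae_filter P"] AE_space[of P] eventually_conj by (metis (mono_tags, lifting))
  define u where "u = (\<lambda>k. f w (s (r k)))"
  have uA: "u k \<in> A" for k
    using f_in w sM by (simp add: u_def)
  have "summable (\<lambda>k. d (u k) (u (Suc k)))"
    using w(2) unfolding u_def by (intro summable_suminf_not_top) (auto simp: CPM_nonneg[OF dC])
  then have "D.MCauchy u"
    using uA by (intro D.MCauchy_if_summable) auto
  then obtain b where "limitin XA u b sequentially"
    using D_complete unfolding D.mcomplete_def D_top by blast
  then have b: "limitin mtopology u b sequentially" "b \<in> A"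
    by (simp_all add: limitin_subtopology)
  have "limitin mtopology (s \<circ> r) b sequentially"
    unfolding limit_metric_sequentially
  proof (intro conjI allI impI)
    show bM: "b \<in> M"
      using b(2) A_in_M by blast
    fix e :: real assume e: "e > 0"
    obtain N1 where N1: "\<And>n. n \<ge> N1 \<Longrightarrow> \<rho> (u n) b < e / 2"
      using b(1) e unfolding limit_metric_sequentially by (meson half_gt_zero)
    \<comment> \<open>The bound \<open>e / 6\<close> absorbs the factor 3 of
      \<open>f_near\<close>.\<close>
    obtain N2 where N2: "\<And>n. n \<ge> N2 \<Longrightarrow> \<sigma> (s n) < e / 6"
      using near[of "e / 6"] e by auto
    have "\<rho> (s (r n)) b < e" if n: "n \<ge> max N1 N2" for n
    proof -
      have "r n \<ge> N2"
        using n seq_suble[OF r, of n] by simp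
      then have "\<rho> (s (r n)) (u n) < e / 2"
        using f_near[OF w(1) sM, of "r n"] N2[of "r n"] by (simp add: u_def)
      moreover have "\<rho> (u n) b < e / 2"
        using N1 n by simp
      ultimately show ?thesis
        using triangle[OF sM A_in_M[OF uA] bM, of "r n" n] by linarith
    qed
    then show "\<exists>N. \<forall>n\<ge>N. (s \<circ> r) n \<in> M \<and> \<rho> ((s \<circ> r) n) b < e"
      using sM by (intro exI[of _ "max N1 N2"]) simp
  qed
  then show ?thesis
    using r by blast
qed

lemma extend_Comp:
  assumes complete: "mcomplete" and d: "d \<in> Comp XA"
  shows "extend d \<in> Comp mtopology"
proof -
  have dM: "d \<in> Met XA"
    using d by (simp add: Comp_def)
  then have dC: "d \<in> CPM XA"
    using Met_subset_CPM by blast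
  have E: "extend d \<in> Met mtopology"
    by (rule extend_Met[OF dM])
  interpret E: Metric_space M "extend d"
    using Met_D(1)[OF E] by simp
  have E_top: "E.mtopology = mtopology"
    using Met_D(2)[OF E] by simp
  have "\<exists>x. limitin E.mtopology s x sequentially" if s: "E.MCauchy s" for s
  proof -
    have sM: "range s \<subseteq> M"
      using s unfolding E.MCauchy_def by (rule conjunct1)
    have cauchy: "\<exists>N. \<forall>m\<ge>N. \<forall>n\<ge>N. extend d (s m) (s n) < e" if "0 < e" for e
      using s that unfolding E.MCauchy_def by meson
    show ?thesis
      unfolding E_top
    proof (cases "\<exists>c>0. \<forall>N. \<exists>n\<ge>N. c \<le> \<sigma> (s n)")
      case True
      then obtain c where c: "0 < c" "\<And>N. \<exists>n\<ge>N. c \<le> \<sigma> (s n)"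
        by auto
      show "\<exists>x. limitin mtopology s x sequentially"
        by (rule extend_MCauchy_away[OF complete dC sM cauchy c])
    next
      case False
      then have near: "\<exists>N. \<forall>n\<ge>N. \<sigma> (s n) < c" if "0 < c" for c
        using that by (meson not_less)
      \<comment> \<open>A convergent subsequence suffices, since \<open>s\<close> is Cauchy for
        \<open>extend d\<close>, which has the same topology.\<close>
      obtain x r where r: "strict_mono r" "limitin mtopology (s \<circ> r) x sequentially"
        using extend_MCauchy_near[OF d sM cauchy near] by auto
      show "\<exists>x. limitin mtopology s x sequentially"
        using E.MCauchy_convergent_subsequence[OF s r(1)] r(2) unfolding E_top by auto
    qed
  qed
  then have "E.mcomplete"
    unfolding E.mcomplete_def by blast
  then show ?thesis
    using E by (simp add: Comp_def)
qed

end

subsection \<open>Existence of random retractions\<close>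

text \<open>Balls \<open>C z\<close> cover \<open>M - A\<close>, each with a point
  \<open>a z\<close> of \<open>A\<close> nearby. Every layer of the Stone refinement
  \<open>D\<close> offers locally a single index, so weights are needed only for the countably many
  layers. Laid end to end they fill the unit interval, and \<open>w\<close> selects a layer, hence a
  point of \<open>A\<close>.\<close>

lemma (in Metric_space) random_retraction_exists:
  assumes closed: "closedin mtopology A" and ne: "A \<noteq> {}"
    and bdd: "\<And>x y. x \<in> M \<Longrightarrow> y \<in> M \<Longrightarrow> d x y \<le> 1"
  obtains P :: "real measure" and f :: "real \<Rightarrow> 'a \<Rightarrow> 'a" where "random_retraction M d A P f"
proof -
  let ?s = "capped_setdist A"
  have AM: "A \<subseteq> M"
    using closed closedin_subset by fastforce
  have spos: "?s x > 0" if "x \<in> M - A" for x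
    using capped_setdist_pos[OF closed that] .
  have sA: "?s x = 0" if "x \<in> A" for x
    using capped_setdist_eq_0 that AM by blast
  have slip: "?s x \<le> d x y + ?s y" if "x \<in> M" "y \<in> M" for x y
    using capped_setdist_triangle that AM by blast
  have "\<exists>b\<in>A. d z b < 2 * ?s z" if z: "z \<in> M - A" for z
  proof -
    obtain a where a: "a \<in> A"
      using ne by blast
    have "?s z < 2 * ?s z"
      using spos[OF z] by simp
    then show ?thesis
    proof (cases rule: capped_setdist_less)
      \<comment> \<open>Here the cap hides the distance to \<open>A\<close>, but
        \<open>1 < 2 * ?s z\<close>, so any point of \<open>A\<close> is near enough by
        \<open>bdd\<close>.\<close>
      case 1
      then show ?thesis
        using bdd[of z a] a AM z by (intro bexI[of _ a]) auto
    qed auto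
  qed
  then obtain a where a: "\<And>z. z \<in> M - A \<Longrightarrow> a z \<in> A" "\<And>z. z \<in> M - A \<Longrightarrow> d z (a z) < 2 * ?s z"
    by metis
  define C where "C = (\<lambda>z. if z \<in> M - A then mball z (?s z / 4) else {})"
  have Copen: "openin mtopology (C z)" for z
    by (simp add: C_def)
  obtain D :: "nat \<Rightarrow> 'a \<Rightarrow> 'a set" where D: "\<forall>n i. openin mtopology (D n i)" "\<forall>n i. D n i \<subseteq> C i"
    and cover: "(\<Union>i. C i) \<subseteq> (\<Union>n i. D n i)"
    and loc: "\<forall>x\<in>\<Union>i. C i. \<exists>r>0. \<exists>K. (\<forall>n\<ge>K. \<forall>i. D n i \<inter> mball x r = {}) \<and>
        (\<forall>n i j. D n i \<inter> mball x r \<noteq> {} \<longrightarrow> D n j \<inter> mball x r \<noteq> {} \<longrightarrow> i = j)"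
    using sigma_discrete_refinement[of C, OF Copen] by (elim exE conjE)
  have Dopen: "openin mtopology (D n i)" and DC: "D n i \<subseteq> C i" for n i
    using D by auto
  have UC: "x \<in> (\<Union>i. C i)" if "x \<in> M - A" for x
    using that spos[OF that] by (auto simp: C_def intro!: bexI[of _ x])
  text \<open>\<open>p n\<close> are the partial sums of a partition of unity subordinate to the open sets \<open>W n\<close>, so for
    \<open>w\<close> uniform in \<open>[0,1)\<close> the layer \<open>N w x\<close> is random with the \<open>n\<close>-th weight as its probability.\<close>

  define W where "W = (\<lambda>n. \<Union>i. D n i)"
  define g where "g = (\<lambda>n. capped_setdist (M - W n))"
  have Wopen: "openin mtopology (W n)" for n
    unfolding W_def using Dopen by blast
  then have Wclosed: "closedin mtopology (M - W n)" for n
    by (metis closedin_diff closedin_topspace topspace_mtopology)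
  have g0: "g n x \<ge> 0" for n x
    by (simp add: g_def capped_setdist_nonneg)
  have gpos: "g n x > 0 \<longleftrightarrow> x \<in> W n" if "x \<in> M" for n x
    using capped_setdist_eq_0[of x "M - W n"] capped_setdist_pos[OF Wclosed, of x n] that
    unfolding g_def by force
  have glip: "\<bar>g n x - g n y\<bar> \<le> d x y" if "x \<in> M" "y \<in> M" for n x y
    unfolding g_def using that by (intro capped_setdist_lipschitz) auto
  define S where "S = (\<lambda>n x. \<Sum>k<n. g k x)"
  define T where "T = (\<lambda>x. \<Sum>k. g k x)"
  define p where "p = (\<lambda>n x. S n x / T x)"
  define N where "N = (\<lambda>w x. LEAST n. w < p (Suc n) x)"
  define c where "c = (\<lambda>n x. SOME i. x \<in> D n i)"
  define f where "f = (\<lambda>w x. if x \<in> A then x else a (c (N w x) x))"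
  \<comment> \<open>The endpoint 1 is left out because the partial sums reach exactly 1: for
    \<open>x\<close> in \<open>M - A\<close> every \<open>w\<close> lies strictly below some
    \<open>p (Suc n) x\<close>, so the \<open>LEAST\<close> in \<open>N\<close> exists.\<close>
  define P where "P = restrict_space lborel {0..<1::real}"
  have spP: "space P = {0..<1}"
    by (simp add: P_def space_restrict_space)
  have PT: "emeasure P (space P) = 1"
    unfolding spP by (simp add: P_def emeasure_restrict_space)
  have Slip: "\<bar>S n x - S n y\<bar> \<le> n * d x y" if "x \<in> M" "y \<in> M" for n x y
  proof -
    have "\<bar>S n x - S n y\<bar> \<le> (\<Sum>k<n. \<bar>g k x - g k y\<bar>)"
      unfolding S_def by (simp add: sum_subtractf[symmetric])
    also have "\<dots> \<le> (\<Sum>k<n. d x y)"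
      by (intro sum_mono glip that)
    finally show ?thesis by simp
  qed
  \<comment> \<open>Near \<open>x\<close> only layers below \<open>K\<close> occur, and layer
    \<open>n\<close> has the single index \<open>b n\<close>; hence \<open>f w y\<close> depends on
    \<open>y\<close> only through \<open>N w y\<close>.\<close>
  have near: "\<exists>r>0. \<exists>K. \<exists>b. \<forall>y\<in>mball x r. y \<in> M - A \<and> T y > 0 \<and> T y = S K y \<and>
      (\<forall>w\<in>{0..<1}. N w y < K \<and> w < p (Suc (N w y)) y \<and> y \<in> D (N w y) (c (N w y) y)
          \<and> c (N w y) y = b (N w y))"
    if x: "x \<in> M - A" for x
  proof -
    obtain r K where r: "r > 0" "\<And>n i. n \<ge> K \<Longrightarrow> D n i \<inter> mball x r = {}"
      "\<And>n i j. D n i \<inter> mball x r \<noteq> {} \<Longrightarrow> D n j \<inter> mball x r \<noteq> {} \<Longrightarrow> i = j"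
      using bspec[OF loc UC[OF x]] by meson
    define b where "b = (\<lambda>n. SOME i. D n i \<inter> mball x r \<noteq> {})"
    \<comment> \<open>Radius at most \<open>?s x\<close> keeps the ball off
      \<open>A\<close>.\<close>
    let ?r = "min r (?s x)"
    have *: "y \<in> M - A \<and> T y > 0 \<and> T y = S K y \<and>
      (\<forall>w\<in>{0..<1}. N w y < K \<and> w < p (Suc (N w y)) y \<and> y \<in> D (N w y) (c (N w y) y)
          \<and> c (N w y) y = b (N w y))"
      if y: "y \<in> mball x ?r" for y
    proof -
      have yM: "y \<in> M - A" "y \<in> mball x r" "y \<in> M"
        using y slip[of x y] sA[of y] by auto
      have gK: "g n y = 0" if "n \<ge> K" for n
      proof -
        have "y \<notin> W n"
          using r(2)[OF that] yM unfolding W_def by blast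
        then show ?thesis
          using gpos[of y n] g0[of n y] yM by auto
      qed
      then have TS: "T y = S K y"
        unfolding T_def S_def by (intro suminf_finite) auto
      obtain n i where n: "y \<in> D n i"
        using cover UC[OF yM(1)] by blast
      then have "n < K"
        using r(2) yM by (meson disjoint_iff not_less)
      moreover have "g n y > 0"
        using n gpos yM unfolding W_def by auto
      ultimately have Tpos: "T y > 0"
        unfolding TS S_def using g0 by (intro sum_pos2[of _ n]) auto
      have K0: "K > 0"
        using \<open>n < K\<close> by simp
      have "N w y < K \<and> w < p (Suc (N w y)) y \<and> y \<in> D (N w y) (c (N w y) y)
          \<and> c (N w y) y = b (N w y)" if w: "w \<in> {0..<1}" for w
      proof -
        have "w < p (Suc (K - 1)) y"
          using w K0 TS Tpos unfolding p_def by simp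
        then have N: "w < p (Suc (N w y)) y" "N w y \<le> K - 1"
          unfolding N_def by (rule LeastI, rule Least_le)
        \<comment> \<open>By minimality, starting from the empty sum \<open>p 0 y = 0\<close>. Hence
          the selected layer has positive weight at \<open>y\<close>, so \<open>y\<close> lies in it
          and the choice \<open>c\<close> is genuine.\<close>
        have "p (N w y) y \<le> w"
        proof (cases "N w y")
          case 0
          then show ?thesis
            using w by (simp add: p_def S_def)
        next
          case (Suc m)
          then have "\<not> w < p (Suc m) y"
            using not_less_Least[of m "\<lambda>n. w < p (Suc n) y"] unfolding N_def by simp
          then show ?thesis
            using Suc by simp
        qed
        then have "p (N w y) y < p (Suc (N w y)) y"
          using N by simp
        then have "g (N w y) y > 0"
          using Tpos unfolding p_def S_def by (simp add: divide_less_cancel)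
        then have "\<exists>i. y \<in> D (N w y) i"
          using gpos yM unfolding W_def by auto
        then have c: "y \<in> D (N w y) (c (N w y) y)"
          unfolding c_def by (rule someI_ex)
        then have "D (N w y) (c (N w y) y) \<inter> mball x r \<noteq> {}"
          using yM by blast
        moreover from this have "D (N w y) (b (N w y)) \<inter> mball x r \<noteq> {}"
          unfolding b_def by (rule someI)
        ultimately have "c (N w y) y = b (N w y)"
          by (rule r(3))
        then show ?thesis
          using N c K0 by auto
      qed
      then show ?thesis
        using yM Tpos TS by blast
    qed
    have "?r > 0"
      using r spos x by auto
    then show ?thesis
      using * by blast
  qed
  have self: "x \<in> mball x r" if "x \<in> M - A" "r > 0" for x r
    using that by auto
  \<comment> \<open>For the selected \<open>z\<close>, \<open>d z x < ?s z / 4\<close> gives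
    \<open>?s z < (4/3) * ?s x\<close>, and \<open>d x (a z) < (1/4 + 2) * ?s z\<close>; the product
    of \<open>9/4\<close> and \<open>4/3\<close> is the constant 3.\<close>
  have fA: "a (c (N w x) x) \<in> A \<and> d x (a (c (N w x) x)) \<le> 3 * ?s x"
    if x: "x \<in> M - A" and w: "w \<in> {0..<1}" for w x
  proof -
    let ?z = "c (N w x) x"
    obtain r where "r > 0" "\<forall>y\<in>mball x r. \<forall>w\<in>{0..<1}. y \<in> D (N w y) (c (N w y) y)"
      using near[OF x] by meson
    then have "x \<in> D (N w x) ?z"
      using self[OF x] w by blast
    then have "x \<in> C ?z"
      using DC by blast
    then have z: "?z \<in> M - A" "d ?z x < ?s ?z / 4"
      unfolding C_def by (auto split: if_splits)
    have az: "a ?z \<in> A" "d ?z (a ?z) < 2 * ?s ?z"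
      using a z by auto
    have "?s ?z \<le> d ?z x + ?s x"
      using slip z x by auto
    moreover have "d x (a ?z) \<le> d ?z x + d ?z (a ?z)"
      using triangle''[of x ?z "a ?z"] z az x AM by auto
    ultimately show ?thesis
      using az z by linarith
  qed
  show thesis
  proof (rule that, unfold_locales)
    show "closedin mtopology A" by (rule closed)
    show "emeasure P (space P) = 1" by (rule PT)
    show "f w x \<in> A" if "w \<in> space P" "x \<in> M" for w x
      using fA[of x w] that unfolding f_def spP by auto
    show "f w x = x" if "x \<in> A" for w x
      using that by (simp add: f_def)
    show "d x (f w x) \<le> 3 * capped_setdist A x" if "w \<in> space P" "x \<in> M" for w x
      using fA[of x w] that capped_setdist_nonneg[of A x] unfolding f_def spP by auto
    show "\<exists>F r. finite F \<and> r > 0 \<and> (\<forall>y\<in>mball x r. \<forall>w\<in>space P. f w y \<in> F)"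
      if x: "x \<in> M - A" for x
    proof -
      obtain r K b where r: "r > 0" "\<forall>y\<in>mball x r. y \<in> M - A \<and>
        (\<forall>w\<in>{0..<1}. N w y < K \<and> c (N w y) y = b (N w y))"
        using near[OF x] by meson
      have "f w y \<in> (\<lambda>n. a (b n)) ` {..<K}" if "y \<in> mball x r" "w \<in> space P" for w y
      proof -
        have "f w y = a (b (N w y))" "N w y < K"
          using r(2) that unfolding f_def spP by (metis DiffD2)+
        then show ?thesis by blast
      qed
      then show ?thesis
        using r by (intro exI[of _ "(\<lambda>n. a (b n)) ` {..<K}"] exI[of _ r]) auto
    qed
    show "simple_function P (\<lambda>w. f w x)" if x: "x \<in> M" for x
    proof (cases "x \<in> A")
      case True
      then show ?thesis
        by (simp add: f_def)
    next
      case False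
      then have x: "x \<in> M - A"
        using x by simp
      obtain r K where r: "r > 0" "\<forall>y\<in>mball x r. \<forall>w\<in>{0..<1}. N w y < K"
        using near[OF x] by meson
      \<comment> \<open>Measurability is checked on the layer number, which is natural-valued with
        finite range; \<open>f w x\<close> is a function of it.\<close>
      have "(\<lambda>w. N w x) ` space P \<subseteq> {..<K}"
        using r self[OF x] unfolding spP by blast
      moreover have "(\<lambda>w. N w x) \<in> measurable lborel (count_space UNIV)"
        unfolding N_def by measurable
      then have "(\<lambda>w. N w x) \<in> measurable P (count_space UNIV)"
        unfolding P_def by (rule measurable_restrict_space1)
      ultimately have "simple_function P (\<lambda>w. N w x)"
        by (simp add: simple_function_eq_measurable finite_subset)
      then show ?thesis
        using False unfolding f_def by (simp add: simple_function_compose1[where g = "\<lambda>n. a (c n x)"])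
    qed
    show "\<exists>r>0. \<forall>y\<in>mball x r. measure P {w \<in> space P. f w y \<noteq> f w x} < e"
      if x: "x \<in> M - A" and e: "e > 0" for x e
    proof -
      obtain r K b where r: "r > 0" and near: "\<forall>y\<in>mball x r. y \<in> M - A \<and> T y > 0 \<and> T y = S K y \<and>
        (\<forall>w\<in>{0..<1}. N w y < K \<and> w < p (Suc (N w y)) y \<and> c (N w y) y = b (N w y))"
        using near[OF x] by meson
      have nx: "x \<in> M - A" "T x > 0" "T x = S K x"
        and nxw: "\<And>w. w \<in> {0..<1} \<Longrightarrow> N w x < K \<and> w < p (Suc (N w x)) x \<and> c (N w x) x = b (N w x)"
        using near self[OF x r] by blast+
      have K: "K > 0"
        using nxw[of 0] by auto
      \<comment> \<open>Each of the \<open>K\<close> breakpoints \<open>p (Suc n)\<close> moves by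
        at most \<open>2 * K * d x y / T x\<close>; \<open>L * d x y\<close> is the total.\<close>
      define L where "L = 2 * real K * real K / T x"
      have L: "L > 0"
        using K nx by (simp add: L_def)
      have "measure P {w \<in> space P. f w y \<noteq> f w x} < e" if y: "y \<in> mball x (min r (e / L))" for y
      proof -
        have yr: "y \<in> mball x r" and yM: "x \<in> M" "y \<in> M"
          using y by auto
        have ny: "y \<in> M - A" "T y > 0" "T y = S K y"
          and nyw: "\<And>w. w \<in> {0..<1} \<Longrightarrow> N w y < K \<and> w < p (Suc (N w y)) y \<and> c (N w y) y = b (N w y)"
          using near yr by blast+
        have pxy: "\<bar>p n x - p n y\<bar> \<le> 2 * K * d x y / T x" if "n \<le> K" for n
        proof -
          have Sy: "0 \<le> S n y" "S n y \<le> T y"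
            unfolding ny(3) unfolding S_def using that g0 by (auto intro: sum_nonneg sum_mono2)
          \<comment> \<open>Splitting this way and using \<open>S n y \<le> T y\<close> leaves a
            factor \<open>T y\<close> that cancels, so the bound involves only \<open>T x\<close>
            and is uniform in \<open>y\<close>.\<close>
          have "\<bar>S n x * T y - S n y * T x\<bar> = \<bar>(S n x - S n y) * T y + S n y * (T y - T x)\<bar>"
            by (simp add: algebra_simps)
          also have "\<dots> \<le> \<bar>S n x - S n y\<bar> * T y + S n y * \<bar>T y - T x\<bar>"
            using abs_triangle_ineq[of "(S n x - S n y) * T y" "S n y * (T y - T x)"] ny(2) Sy(1)
            by (simp add: abs_mult)
          also have "\<dots> \<le> (n * d x y) * T y + T y * (K * d x y)"
            using Slip[OF yM, of n] Slip[OF yM, of K] Sy ny nx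
            by (intro add_mono mult_mono) (auto simp: abs_minus_commute)
          also have "\<dots> \<le> (2 * K * d x y) * T y"
          proof -
            have "real n * d x y * T y \<le> real K * d x y * T y"
              using that ny(2) by (intro mult_right_mono) auto
            then show ?thesis by (simp add: algebra_simps)
          qed
          finally have bnd: "\<bar>S n x * T y - S n y * T x\<bar> \<le> (2 * K * d x y) * T y" .
          have "p n x - p n y = (S n x * T y - S n y * T x) / (T x * T y)"
            using nx ny unfolding p_def by (simp add: field_simps)
          then have "\<bar>p n x - p n y\<bar> = \<bar>S n x * T y - S n y * T x\<bar> / (T x * T y)"
            using nx(2) ny(2) by (simp add: abs_mult)
          also have "\<dots> \<le> (2 * K * d x y) * T y / (T x * T y)"
            using bnd nx(2) ny(2) by (intro divide_right_mono) auto
          also have "\<dots> = 2 * K * d x y / T x"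
            using ny(2) by simp
          finally show ?thesis .
        qed
        \<comment> \<open>Different values require different layers. If \<open>m\<close> is the
          smaller one, \<open>w\<close> lies below the breakpoint \<open>p (Suc m)\<close> at one
          point but not at the other, hence between the two.\<close>
        let ?I = "\<lambda>n. {min (p (Suc n) x) (p (Suc n) y) ..< max (p (Suc n) x) (p (Suc n) y)}"
        have "{w \<in> space P. f w y \<noteq> f w x} \<subseteq> (\<Union>n<K. ?I n)"
        proof
          fix w assume "w \<in> {w \<in> space P. f w y \<noteq> f w x}"
          then have w: "w \<in> {0..<1}" "f w y \<noteq> f w x"
            by (auto simp: spP)
          then have "N w x \<noteq> N w y"
            using nxw[OF w(1)] nyw[OF w(1)] nx ny unfolding f_def by auto
          moreover have "w \<in> ?I m" if "m = N w x" "m < N w y" for m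
            using nxw[OF w(1)] that not_less_Least[of m "\<lambda>n. w < p (Suc n) y"]
            unfolding N_def by auto
          moreover have "w \<in> ?I m" if "m = N w y" "m < N w x" for m
            using nyw[OF w(1)] that not_less_Least[of m "\<lambda>n. w < p (Suc n) x"]
            unfolding N_def by auto
          ultimately have "w \<in> ?I (N w x) \<or> w \<in> ?I (N w y)"
            by (meson nat_neq_iff)
          then show "w \<in> (\<Union>n<K. ?I n)"
            using nxw[OF w(1)] nyw[OF w(1)] by blast
        qed
        then have "emeasure lborel {w \<in> space P. f w y \<noteq> f w x} \<le> emeasure lborel (\<Union>n<K. ?I n)"
          by (intro emeasure_mono) auto
        moreover have "emeasure lborel (\<Union>n<K. ?I n) < top"
          by (intro emeasure_bounded_finite[simplified infinity_ennreal_def] bounded_UN) auto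
        moreover have "measure P {w \<in> space P. f w y \<noteq> f w x} = measure lborel {w \<in> space P. f w y \<noteq> f w x}"
          unfolding P_def by (rule measure_restrict_space) (auto simp: space_restrict_space)
        ultimately have "measure P {w \<in> space P. f w y \<noteq> f w x} \<le> measure lborel (\<Union>n<K. ?I n)"
          unfolding measure_def by (simp add: enn2real_mono)
        also have "\<dots> \<le> (\<Sum>n<K. measure lborel (?I n))"
          by (intro measure_UNION_le) auto
        also have "\<dots> \<le> (\<Sum>n<K. 2 * K * d x y / T x)"
        proof (intro sum_mono)
          fix n assume "n \<in> {..<K}"
          then have "\<bar>p (Suc n) x - p (Suc n) y\<bar> \<le> 2 * K * d x y / T x"
            by (intro pxy) simp
          moreover have "measure lborel (?I n) = \<bar>p (Suc n) x - p (Suc n) y\<bar>"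
            by (simp add: min_def max_def)
          ultimately show "measure lborel (?I n) \<le> 2 * K * d x y / T x"
            by simp
        qed
        also have "\<dots> = L * d x y"
          by (simp add: L_def)
        also have "\<dots> < e"
          using y L by (simp add: field_simps)
        finally show ?thesis .
      qed
      then show ?thesis
        using r e L by (intro exI[of _ "min r (e / L)"]) auto
    qed
  qed
qed

subsection \<open>The isometric extensor\<close>

lemma sup_dist_lessD:
  assumes "sup_dist Z d e < ennreal c" "x \<in> topspace Z" "y \<in> topspace Z"
  shows "\<bar>d x y - e x y\<bar> < c"
proof -
  have "ennreal \<bar>d x y - e x y\<bar> \<le> sup_dist Z d e"
    unfolding sup_dist_def using assms(2,3) by (intro SUP_upper2[of "(x, y)"]) auto
  then have "ennreal \<bar>d x y - e x y\<bar> < ennreal c"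
    using assms(1) by (rule order_le_less_trans)
  then show ?thesis
    by (simp add: ennreal_less_iff)
qed

lemma sup_dist_restrict2_le:
  "sup_dist (subtopology X A) (restrict2 d A) (restrict2 e A) \<le> sup_dist X d e"
  unfolding sup_dist_def
proof (rule SUP_mono)
  fix p assume "p \<in> topspace (subtopology X A) \<times> topspace (subtopology X A)"
  then show "\<exists>q\<in>topspace X \<times> topspace X.
      (case p of (x, y) \<Rightarrow> ennreal \<bar>restrict2 d A x y - restrict2 e A x y\<bar>)
        \<le> (case q of (x, y) \<Rightarrow> ennreal \<bar>d x y - e x y\<bar>)"
    by (intro bexI[of _ p]) (auto simp: restrict2_def)
qed

text \<open>For \<open>m\<close> outside the image, \<open>m' = E (restrict2 m A)\<close> differs
  from \<open>m\<close> at some pair. An \<open>E d\<close> within \<epsilon> of \<open>m\<close>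
  has \<open>d\<close> within \<epsilon> of \<open>restrict2 m A\<close>, so by isometry it is
  within \<epsilon> of \<open>m'\<close>; with \<epsilon> half the gap at that pair this is
  impossible.\<close>

lemma closedin_isometric_extensor_image:
  assumes A: "A \<subseteq> topspace X" and E: "E \<in> Met (subtopology X A) \<rightarrow> Met X"
    and restr: "\<And>d. d \<in> Met (subtopology X A) \<Longrightarrow> restrict2 (E d) A = d"
    and iso: "\<And>d e. d \<in> Met (subtopology X A) \<Longrightarrow> e \<in> Met (subtopology X A) \<Longrightarrow>
      sup_dist (subtopology X A) d e = sup_dist X (E d) (E e)"
  shows "closedin (sup_topology X (Met X)) (E ` Met (subtopology X A))"
proof -
  let ?I = "E ` Met (subtopology X A)"
  have "\<exists>\<epsilon>>0. \<forall>e\<in>Met X. sup_dist X m e < ennreal \<epsilon> \<longrightarrow> e \<in> Met X - ?I" if m: "m \<in> Met X - ?I" for m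
  proof -
    define m' where "m' = E (restrict2 m A)"
    have mA: "restrict2 m A \<in> Met (subtopology X A)"
      using m A restrict2_Met by blast
    have m'I: "m' \<in> ?I"
      using mA unfolding m'_def by (rule imageI)
    then have m': "m' \<in> Met X" "m' \<noteq> m"
      using E m by auto
    then obtain x y where xy: "m' x y \<noteq> m x y"
      by (meson ext)
    then have xyX: "x \<in> topspace X" "y \<in> topspace X"
      using Met_D(3)[OF m'(1)] Met_D(3)[of m X] m unfolding vanishes_off_def by auto
    define \<epsilon> where "\<epsilon> = \<bar>m' x y - m x y\<bar> / 2"
    have "e \<notin> ?I" if e: "sup_dist X m e < ennreal \<epsilon>" for e
    proof
      assume "e \<in> ?I"
      then obtain d where d: "d \<in> Met (subtopology X A)" "e = E d"
        by blast
      have "sup_dist X m' e = sup_dist (subtopology X A) (restrict2 m A) (restrict2 e A)"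
        unfolding m'_def d(2) restr[OF d(1)] by (rule iso[OF mA d(1), symmetric])
      also have "\<dots> \<le> sup_dist X m e"
        by (rule sup_dist_restrict2_le)
      finally have "sup_dist X m' e < ennreal \<epsilon>"
        using e by (rule order_le_less_trans)
      then have "\<bar>m' x y - e x y\<bar> < \<epsilon>" "\<bar>m x y - e x y\<bar> < \<epsilon>"
        using sup_dist_lessD[OF _ xyX] e by auto
      moreover have "\<bar>m' x y - m x y\<bar> \<le> \<bar>m' x y - e x y\<bar> + \<bar>m x y - e x y\<bar>"
        by linarith
      ultimately show False
        by (simp add: \<epsilon>_def)
    qed
    moreover have "\<epsilon> > 0"
      using xy by (simp add: \<epsilon>_def)
    ultimately show ?thesis
      by blast
  qed
  then have "openin (sup_topology X (Met X)) (Met X - ?I)"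
    unfolding openin_sup_topology by blast
  then show ?thesis
    using E unfolding closedin_def topspace_sup_topology by blast
qed

text \<open>Capping at 1 preserves topology and completeness, so starting from a complete metric
  whenever one exists lets one \<rho> serve all claims.\<close>

lemma metrizable_by_capped_metric:
  assumes "metrizable_space X"
  obtains \<rho> where "\<rho> \<in> Met X" "\<And>x y. \<rho> x y \<le> 1"
    "completely_metrizable_space X \<Longrightarrow> Metric_space.mcomplete (topspace X) \<rho>"
proof -
  obtain M d where d: "Metric_space M d" "X = Metric_space.mtopology M d"
    "completely_metrizable_space X \<longrightarrow> Metric_space.mcomplete M d"
    using assms unfolding metrizable_space_def completely_metrizable_space_def by blast
  interpret Metric_space M d by fact
  interpret C: Metric_space M "capped_dist 1"
    by (rule capped_dist)
  let ?\<rho> = "restrict2 (capped_dist 1) M"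
  have M: "topspace X = M"
    using d(2) by simp
  show thesis
  proof
    show "?\<rho> \<in> Met X"
      unfolding Met_def M using C.Metric_space_restrict2 C.mtopology_restrict2 mtopology_capped_metric[of 1] d(2)
      by (simp add: vanishes_off_def) (simp add: restrict2_def)
    show "?\<rho> x y \<le> 1" for x y
      by (simp add: restrict2_def capped_dist_def)
    show "Metric_space.mcomplete (topspace X) ?\<rho>" if "completely_metrizable_space X"
      unfolding M C.mcomplete_restrict2 mcomplete_capped_metric using d(3) that by blast
  qed
qed

lemma isometric_extensor_exists:
  assumes X: "metrizable_space X" and A: "closedin X A"
  obtains E where "E \<in> CPM (subtopology X A) \<rightarrow> CPM X"
    "\<And>d. d \<in> CPM (subtopology X A) \<Longrightarrow> restrict2 (E d) A = d"
    "\<And>d e. d \<in> CPM (subtopology X A) \<Longrightarrow> e \<in> CPM (subtopology X A) \<Longrightarrow>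
      sup_dist X (E d) (E e) = sup_dist (subtopology X A) d e"
    "E ` Met (subtopology X A) \<subseteq> Met X" "E ` BMet (subtopology X A) \<subseteq> BMet X"
    "completely_metrizable_space X \<Longrightarrow> E ` Comp (subtopology X A) \<subseteq> Comp X"
proof -
  obtain \<rho> where \<rho>: "\<rho> \<in> Met X" "\<And>x y. \<rho> x y \<le> 1"
    "completely_metrizable_space X \<Longrightarrow> Metric_space.mcomplete (topspace X) \<rho>"
    using metrizable_by_capped_metric[OF X] by blast
  interpret Metric_space "topspace X" \<rho>
    using Met_D(1)[OF \<rho>(1)] .
  have top: "mtopology = X"
    using Met_D(2)[OF \<rho>(1)] .
  show thesis
  proof (cases "A = {}")
    \<comment> \<open>There is nothing to retract onto. The zero function is the only element of
      \<open>CPM\<close> on the empty space and the supremum over no pairs is 0, so the constant map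
      with value \<rho> works.\<close>
    case True
    have zero: "d = (\<lambda>_ _. 0)" if "d \<in> CPM (subtopology X A)" for d
      using CPM_off[OF that] True by (intro ext) simp
    have "mbounded (topspace X)"
      unfolding mbounded_alt using \<rho>(2) by blast
    then have BMet: "\<rho> \<in> BMet X"
      using \<rho>(1) by (simp add: BMet_def)
    show thesis
    proof (rule that[of "\<lambda>_. \<rho>"])
      show "restrict2 \<rho> A = d" if "d \<in> CPM (subtopology X A)" for d
        unfolding zero[OF that] True restrict2_def by simp
      show "sup_dist X \<rho> \<rho> = sup_dist (subtopology X A) d e" for d e
        unfolding sup_dist_def True by (auto simp: bot_ennreal intro!: antisym SUP_least)
    qed (use \<rho> BMet Met_subset_CPM in \<open>auto simp: Comp_def\<close>)
  next
    case False
    obtain P :: "real measure" and f where "random_retraction (topspace X) \<rho> A P f"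
      using random_retraction_exists[of A] A False \<rho>(2) unfolding top by blast
    then interpret R: random_retraction "topspace X" \<rho> A P f .
    show thesis
    proof (rule that[of R.extend])
      show "R.extend \<in> CPM (subtopology X A) \<rightarrow> CPM X"
        using R.extend_CPM unfolding top by blast
      show "restrict2 (R.extend d) A = d" if "d \<in> CPM (subtopology X A)" for d
        using R.restrict2_extend that unfolding top by blast
      show "sup_dist X (R.extend d) (R.extend e) = sup_dist (subtopology X A) d e"
        if "d \<in> CPM (subtopology X A)" "e \<in> CPM (subtopology X A)" for d e
        using R.sup_dist_extend that unfolding top by blast
      show "R.extend ` Met (subtopology X A) \<subseteq> Met X"
        using R.extend_Met unfolding top by blast
      show "R.extend ` BMet (subtopology X A) \<subseteq> BMet X"
        using R.extend_BMet \<rho>(2) unfolding top by blast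
      show "R.extend ` Comp (subtopology X A) \<subseteq> Comp X" if "completely_metrizable_space X"
        using R.extend_Comp \<rho>(3)[OF that] unfolding top by blast
    qed
  qed
qed

theorem theorem1p1:
  fixes X :: "'a topology" and A :: "'a set"
  assumes "metrizable_space X" and "closedin X A"
  shows "\<exists>E \<in> Met (subtopology X A) \<rightarrow> Met X.
      (\<forall>d \<in> Met (subtopology X A). restrict2 (E d) A = d) \<and>
      (\<forall>d \<in> Met (subtopology X A). \<forall>e \<in> Met (subtopology X A).
         sup_dist (subtopology X A) d e = sup_dist X (E d) (E e)) \<and>
      E ` BMet (subtopology X A) \<subseteq> BMet X \<and>
      (completely_metrizable_space X \<longrightarrow> E ` Comp (subtopology X A) \<subseteq> Comp X) \<and>
      (\<exists>E' \<in> CPM (subtopology X A) \<rightarrow> CPM X.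
         (\<forall>d \<in> CPM (subtopology X A). restrict2 (E' d) A = d) \<and>
         (\<forall>d \<in> CPM (subtopology X A). \<forall>e \<in> CPM (subtopology X A).
            sup_dist X (E' d) (E' e) = sup_dist (subtopology X A) d e) \<and>
         (\<forall>d \<in> Met (subtopology X A). E' d = E d) \<and>
         E' ` Met (subtopology X A) = E' ` CPM (subtopology X A) \<inter> Met X) \<and>
      closedin (sup_topology X (Met X)) (E ` Met (subtopology X A))"
proof -
  let ?XA = "subtopology X A"
  have A: "A \<subseteq> topspace X"
    using assms(2) closedin_subset by blast
  obtain E where E: "E \<in> CPM ?XA \<rightarrow> CPM X"
    and restr: "\<And>d. d \<in> CPM ?XA \<Longrightarrow> restrict2 (E d) A = d"
    and iso: "\<And>d e. d \<in> CPM ?XA \<Longrightarrow> e \<in> CPM ?XA \<Longrightarrow> sup_dist X (E d) (E e) = sup_dist ?XA d e"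
    and Met: "E ` Met ?XA \<subseteq> Met X" and BMet: "E ` BMet ?XA \<subseteq> BMet X"
    and Comp: "completely_metrizable_space X \<Longrightarrow> E ` Comp ?XA \<subseteq> Comp X"
    using isometric_extensor_exists[OF assms] by blast
  have CPM: "d \<in> CPM ?XA" if "d \<in> Met ?XA" for d
    using that Met_subset_CPM by blast
  \<comment> \<open>Restricting a metric \<open>E d\<close> to \<open>A\<close> gives back
    \<open>d\<close>, which is therefore itself a metric for \<open>A\<close>.\<close>
  have "E d \<in> E ` Met ?XA" if "d \<in> CPM ?XA" "E d \<in> Met X" for d
    using restrict2_Met[OF that(2) A] restr[OF that(1)] by simp
  then have image: "E ` Met ?XA = E ` CPM ?XA \<inter> Met X"
    using Met CPM by blast
  have closed: "closedin (sup_topology X (Met X)) (E ` Met ?XA)"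
    using A Met restr iso CPM by (intro closedin_isometric_extensor_image) auto
  \<comment> \<open>One map serves as both extensors, since \<open>Met\<close> is contained in
    \<open>CPM\<close>.\<close>
  have "\<exists>E'\<in>CPM ?XA \<rightarrow> CPM X. (\<forall>d\<in>CPM ?XA. restrict2 (E' d) A = d) \<and>
      (\<forall>d\<in>CPM ?XA. \<forall>e\<in>CPM ?XA. sup_dist X (E' d) (E' e) = sup_dist ?XA d e) \<and>
      (\<forall>d\<in>Met ?XA. E' d = E d) \<and> E' ` Met ?XA = E' ` CPM ?XA \<inter> Met X"
    by (rule bexI[OF _ E]) (simp add: restr iso flip: image)
  moreover have "E \<in> Met ?XA \<rightarrow> Met X" "\<forall>d\<in>Met ?XA. restrict2 (E d) A = d"
    "\<forall>d\<in>Met ?XA. \<forall>e\<in>Met ?XA. sup_dist ?XA d e = sup_dist X (E d) (E e)"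
    "completely_metrizable_space X \<longrightarrow> E ` Comp ?XA \<subseteq> Comp X"
    using Met Comp by (auto simp: restr iso CPM)
  ultimately show ?thesis
    using BMet closed by - (rule bexI[of _ E], intro conjI)
qed

end
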